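(* Let $C=\bigcap_{j=1}^s\{x\in\mathbb{R}^n\mid\langle x_*^j,x\rangle\le c_j\}$ with $\|x_*^j\|=1$ for $j=1,\dots,s$, let $T>0$, and consider the controlled time-delayed sweeping system $$ \begin{aligned} -\dot x(t)&\in N_C\big(x(t)\big)+g\big(t,x(t),x(t-\delta(t)),u(t)\big)\quad\text{a.e. } t\in[0,T],\\ x(s)&=\phi(s),\quad s\in[-\Delta,0],\\ u(t)&\in U\quad\text{a.e. } t\in[0,T]. \end{aligned}\tag{S} $$ Assume: (H1) $U$ is a nonempty compact subset of $\mathbb{R}^d$. (H2) $g:[0,T]\times\mathbb{R}^n\times\mathbb{R}^n\times\mathbb{R}^d\to\mathbb{R}^n$ is continuous in $(t,x,y,u)$, and it is Lipschitz continuous with respect to $(t,x,y)$ uniformly on $U$ whenever $(x,y)$ belongs to a bounded subset of $\mathbb{R}^n\times\mathbb{R}^n$. (H3) There is $\beta>0$ such that $\|g(t,x,y,u)\|\le\beta(1+\|x\|+\|y\|)$ for all $t\in[0,T]$ and $(x,y,u)\in\mathbb{R}^n\times\mathbb{R}^n\times U$. (H4) $\delta:[0,T]\to[0,\infty)$ is Lipschitz continuous, nonincreasing, and $0<\Delta:=\max\{\delta(t)\mid t\in[0,T]\}<\infty$. (H5) $\phi:[-\Delta,0]\to\mathbb{R}^n$ is Lipschitz continuous. Let $(\overline x(\cdot),\overline u(\cdot))$ be a feasible process for (S) with a control representative $\overline u(\cdot)$ of bounded variation and right continuous on $[0,T)$. For $m\in\mathbb{N}$ put $h_m:=T/2^m$,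 $t_m^i:=ih_m$ for $i=0,\dots,2^m$, and $I_m^i:=[t_m^{i-1},t_m^i)$ for $i=1,\dots,2^m$. Then for each $m\in\mathbb{N}$ there exist state-control pairs $(x_m(t),u_m(t))$ and perturbation terms $r_m(t)\ge0$ and $\rho_m(t)\in\mathbb{B}$, $0\le t\le T$, for which the following hold: (i) The sequence of control mappings $u_m:[0,T]\to U$, which are constant on each interval $I_m^i$, converges to $\overline u(\cdot)$ strongly in $L^2([0,T],\mathbb{R}^d)$ and pointwise on $[0,T]$. (ii) The sequence of continuous state mappings $x_m:[0,T]\to\mathbb{R}^n$, which are affine on each interval $I_m^i$, converges strongly in $W^{1,2}([0,T],\mathbb{R}^n)$ to $\overline x(\cdot)$ and satisfies the discrete-time state constraints $$x_m(t_m^i)=\overline x(t_m^i)\in C\ \text{ for each } i=1,\dots,2^m\ \text{ with }\ x_m(0)=\phi(0)=x_0.$$ (iii) For all $t\in(t_m^{i-1},t_m^i)$ and $i=1,\dots,2^m$, $$\dot x_m(t)\in-N_C\big(x_m(t_m^i)\big)+g\big(t_m^i,x_m(t_m^i),x_m(t_m^i-\delta(t_m^i)),u_m(t)\big)+r_m(t)\rho_m(t),$$ together with $x_m(s)=\phi(s)$ for $s\in[-\Delta,0]$ and $u_m(t)\in U$ for $t\in[0,T]$, where the mappings $r_m:[0,T]\to[0,\infty)$ and $\rho_m:[0,T]\to\mathbb{B}$ are constant on each interval $I_m^i$ with $r_m(\cdot)\to0$ in $L^2(0,T)$ as $m\to\infty$. Moreover, all $x_m(\cdot)$ are Lipschitz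 continuous on $[0,T]$ with the same Lipschitz constant as $\overline x(\cdot)$.
   Context: $N_C(x)$ is the normal cone of convex analysis: $N_C(x):=\{v\in\mathbb{R}^n\mid\langle v,y-x\rangle\le0\ \text{for all } y\in C\}$ if $x\in C$, and $N_C(x):=\emptyset$ if $x\notin C$. $\mathbb{B}$ is the closed unit ball of $\mathbb{R}^n$. A feasible process for (S) is a pair $(x(\cdot),u(\cdot))$ such that $u(\cdot)$ is measurable, $x(\cdot)\in W^{1,2}([0,T],\mathbb{R}^n)$ (extended by $\phi$ to $[-\Delta,0]$), and all the relations in (S) hold; in particular $x(t)\in C$ for all $t\in[0,T]$. A representative of a measurable function is a function that agrees with it almost everywhere.
   Formalization: In (iii) the term g is taken with a minus sign, as (S) forces (with C=R, g=1 the printed +g would need r_m≥2); pointwise convergence of u_m at t=T is claimed only if ū(T) lies in U, since otherwise U-valued u_m(T) cannot converge to ū(T). *)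

theory Defs
  imports "HOL-Analysis.Analysis"
begin

definition normal_cone :: "'a::real_inner set \<Rightarrow> 'a \<Rightarrow> 'a set" where
  "normal_cone C x = (if x \<in> C then {v. \<forall>y\<in>C. v \<bullet> (y - x) \<le> 0} else {})"

text \<open>
  The members of a division are nonempty compact intervals \<open>k = {Inf k..Sup k}\<close>, so
  \<open>f (Sup k) - f (Inf k)\<close> is the increment of \<open>f\<close> over \<open>k\<close>.
\<close>

definition bounded_variation_on :: "(real \<Rightarrow> 'a::real_normed_vector) \<Rightarrow> real \<Rightarrow> real \<Rightarrow> bool" where
  "bounded_variation_on f a b \<longleftrightarrow>
     (\<exists>B. \<forall>d. d division_of {a..b} \<longrightarrow> (\<Sum>k\<in>d. norm (f (Sup k) - f (Inf k))) \<le> B)"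

definition abs_continuous_on :: "(real \<Rightarrow> 'a::real_normed_vector) \<Rightarrow> real \<Rightarrow> real \<Rightarrow> bool" where
  "abs_continuous_on f a b \<longleftrightarrow>
     (\<forall>\<epsilon>>0. \<exists>\<eta>>0. \<forall>d S. d division_of S \<and> S \<subseteq> {a..b} \<and> (\<Sum>k\<in>d. Sup k - Inf k) < \<eta>
        \<longrightarrow> (\<Sum>k\<in>d. norm (f (Sup k) - f (Inf k))) < \<epsilon>)"

definition in_L2 :: "real set \<Rightarrow> (real \<Rightarrow> 'a::euclidean_space) \<Rightarrow> bool" where
  "in_L2 S f \<longleftrightarrow> f \<in> borel_measurable (lebesgue_on S) \<and>
     integrable (lebesgue_on S) (\<lambda>t. (norm (f t))\<^sup>2)"

definition L2_norm :: "real set \<Rightarrow> (real \<Rightarrow> 'a::euclidean_space) \<Rightarrow> real" where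
  "L2_norm S f = sqrt (LINT t|lebesgue_on S. (norm (f t))\<^sup>2)"

text \<open>Membership in \<open>L\<^sup>2\<close> is required explicitly: the Bochner integral of a
  non-integrable function is 0.\<close>

definition tendsto_L2 ::
    "real set \<Rightarrow> (nat \<Rightarrow> real \<Rightarrow> 'a::euclidean_space) \<Rightarrow> (real \<Rightarrow> 'a) \<Rightarrow> bool" where
  "tendsto_L2 S f g \<longleftrightarrow> (\<forall>m. in_L2 S (f m)) \<and> in_L2 S g \<and>
     (\<lambda>m. L2_norm S (\<lambda>t. f m t - g t)) \<longlonglongrightarrow> 0"

abbreviation velocity :: "(real \<Rightarrow> 'a::real_normed_vector) \<Rightarrow> real \<Rightarrow> 'a" where
  "velocity x t \<equiv> vector_derivative x (at t)"

text \<open>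
  \<open>W\<^sup>1\<^sup>,\<^sup>2([0,T])\<close> as the space of absolutely continuous functions with
  square integrable derivative. The functions considered may also have values outside
  \<open>[0,T]\<close>; these affect the two-sided derivative only at the endpoints, a null set.
\<close>

definition in_W12 :: "real \<Rightarrow> (real \<Rightarrow> 'a::euclidean_space) \<Rightarrow> bool" where
  "in_W12 T x \<longleftrightarrow> abs_continuous_on x 0 T \<and>
     (AE t in lebesgue_on {0..T}. x differentiable (at t)) \<and>
     in_L2 {0..T} (velocity x)"

definition tendsto_W12 ::
    "real \<Rightarrow> (nat \<Rightarrow> real \<Rightarrow> 'a::euclidean_space) \<Rightarrow> (real \<Rightarrow> 'a) \<Rightarrow> bool" where
  "tendsto_W12 T x y \<longleftrightarrow> (\<forall>m. in_W12 T (x m)) \<and> in_W12 T y \<and>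
     tendsto_L2 {0..T} x y \<and> tendsto_L2 {0..T} (\<lambda>m. velocity (x m)) (velocity y)"

text \<open>
  A state is a function on \<open>\<real>\<close> of which only the values on \<open>[-\<Delta>,T]\<close> matter; on
  \<open>[-\<Delta>,0]\<close> it is the history \<open>\<phi>\<close>. All conditions on the control are insensitive to
  null sets, so every representative of a feasible control is feasible.
\<close>

definition feasible_process ::
    "'a::euclidean_space set \<Rightarrow> 'b::euclidean_space set \<Rightarrow> (real \<Rightarrow> 'a \<Rightarrow> 'a \<Rightarrow> 'b \<Rightarrow> 'a) \<Rightarrow>
     (real \<Rightarrow> real) \<Rightarrow> real \<Rightarrow> (real \<Rightarrow> 'a) \<Rightarrow> real \<Rightarrow> (real \<Rightarrow> 'a) \<Rightarrow> (real \<Rightarrow> 'b) \<Rightarrow> bool" where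
  "feasible_process C U g \<delta> \<Delta> \<phi> T x u \<longleftrightarrow>
     u \<in> borel_measurable (lebesgue_on {0..T}) \<and>
     in_W12 T x \<and>
     (AE t in lebesgue_on {0..T}.
        - velocity x t \<in> {\<nu> + g t (x t) (x (t - \<delta> t)) (u t) |\<nu>. \<nu> \<in> normal_cone C (x t)}) \<and>
     (\<forall>s\<in>{-\<Delta>..0}. x s = \<phi> s) \<and>
     (AE t in lebesgue_on {0..T}. u t \<in> U) \<and>
     (\<forall>t\<in>{0..T}. x t \<in> C)"

definition grid_pt :: "real \<Rightarrow> nat \<Rightarrow> nat \<Rightarrow> real" where
  "grid_pt T m i = real i * (T / 2 ^ m)"

definition grid_cell :: "real \<Rightarrow> nat \<Rightarrow> nat \<Rightarrow> real set" where
  "grid_cell T m i = {grid_pt T m (i - 1)..<grid_pt T m i}"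

end

(*
  A feasible state x has velocity orthogonal to its normal cone, so |x'| <= |f| with
  f(t) = g(t, x(t), x(t - delta(t)), u(t)), and x is Lipschitz.  The approximations interpolate x at the
  dyadic grid and sample u at the right end of each cell; the residual r_m is the distance of
  -(difference quotient) - g to the normal cone at the right grid point.  That normal cone moves with m,
  and strong convergence r_m -> 0 rests on a persistence property of polyhedra: at almost every t the
  normal v = -x'(t) - f(t) remains a normal at x(s) for all s > t close to t.  Hence r_m -> 0 almost
  everywhere, and dominated convergence gives the rest.
*)

theory Submission
  imports Defs
begin

section \<open>Absolutely continuous functions\<close>

text \<open>Near a point the normal cones of a polyhedron can only shrink, so the distance from a
  fixed normal to the cone at \<open>x s\<close> may jump from 0 to a positive value as the
  trajectory leaves a face. Continuity of the data alone does not make the residual small; the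
  dynamics must enter. They exclude such a jump forward in time, given right continuity of the
  perturbation. Hence control, cone and \<open>g\<close> are sampled at the right end of the cell,
  which lies strictly to the right of \<open>t\<close> and tends to \<open>t\<close>. Polyhedrality
  enters twice: cones near \<open>x t\<close> are contained in the cone at \<open>x t\<close>, and
  finiteness of their number separates a normal uniformly from all cones that miss it.\<close>

lemma abs_continuous_on_subinterval:
  assumes "abs_continuous_on f a b" "a \<le> c" "d \<le> b"
  shows "abs_continuous_on f c d"
proof -
  have "{c..d} \<subseteq> {a..b}"
    using assms by auto
  then show ?thesis
    using assms(1) unfolding abs_continuous_on_def by (meson subset_trans)
qed

lemma negligible_outer_open:
  assumes "negligible N" "(e::real) > 0"
  obtains V where "open V" "N \<subseteq> V" "V \<in> lmeasurable" "measure lebesgue V < e"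
proof -
  obtain V where V: "open V" "N \<subseteq> V" "V - N \<in> lmeasurable" "emeasure lebesgue (V - N) < ennreal e"
    using sets_lebesgue_outer_open[OF negligible_imp_sets[OF assms(1)] assms(2)] .
  have "V = (V - N) \<union> N"
    using V(2) by blast
  then have "V \<in> lmeasurable"
    using V(3) negligible_imp_measurable[OF assms(1)] by (metis fmeasurable.Un)
  moreover have "measure lebesgue V = measure lebesgue (V - N)"
    using assms(1) calculation by (simp add: measure_Diff_null_set negligible_iff_null_sets)
  moreover have "measure lebesgue (V - N) < e"
    using V(3,4) assms(2) by (simp add: emeasure_eq_measure2 ennreal_less_iff)
  ultimately show thesis
    using that V(1,2) by metis
qed

text \<open>
  A Cousin-type argument: on a tagged division that is fine enough, intervals tagged in the exceptional null
  set lie in an open set of small measure and are controlled by absolute continuity; the others are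
  controlled by the derivative at the tag.
\<close>

lemma abs_continuous_on_increment_le:
  fixes f :: "real \<Rightarrow> 'a::real_inner"
  assumes ac: "abs_continuous_on f a b" and "a \<le> b" "0 \<le> M"
    and ae: "AE t in lebesgue_on {a..b}. f differentiable (at t) \<and> v \<bullet> velocity f t \<le> M"
  shows "v \<bullet> (f b - f a) \<le> M * (b - a)"
proof -
  define N where "N = {t \<in> {a..b}. \<not> (f differentiable (at t) \<and> v \<bullet> velocity f t \<le> M)}"
  have "AE t in lebesgue. t \<in> {a..b} \<longrightarrow> f differentiable (at t) \<and> v \<bullet> velocity f t \<le> M"
    using ae by (subst (asm) AE_restrict_space_iff) auto
  then have "negligible N"
    unfolding N_def eventually_ae_filter_negligible by (auto elim!: negligible_subset)
  \<comment> \<open>The slack has two sources: \<open>\<epsilon> * (b - a)\<close> is the error of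
    differentiation at tags off \<open>N\<close>, and \<open>norm v * \<epsilon>\<close> bounds the
    total increment over intervals tagged in \<open>N\<close>.\<close>
  have bound: "v \<bullet> (f b - f a) \<le> (M + \<epsilon>) * (b - a) + norm v * \<epsilon>" if "\<epsilon> > 0" for \<epsilon>
  proof -
    obtain \<eta> where "\<eta> > 0"
      and \<eta>: "\<And>d S. d division_of S \<Longrightarrow> S \<subseteq> {a..b} \<Longrightarrow> (\<Sum>k\<in>d. Sup k - Inf k) < \<eta> \<Longrightarrow>
              (\<Sum>k\<in>d. norm (f (Sup k) - f (Inf k))) < \<epsilon>"
      using ac \<open>\<epsilon> > 0\<close> unfolding abs_continuous_on_def by meson
    obtain V where V: "open V" "N \<subseteq> V" "V \<in> lmeasurable" "measure lebesgue V < \<eta>"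
      using negligible_outer_open[OF \<open>negligible N\<close> \<open>\<eta> > 0\<close>] .
    have "\<exists>d>0. \<forall>y. \<bar>y - t\<bar> < d \<longrightarrow> 
            \<bar>v \<bullet> (f y - f t) - (y - t) * (v \<bullet> velocity f t)\<bar> \<le> \<epsilon> * \<bar>y - t\<bar>"
      if "t \<in> {a..b} - N" for t
    proof -
      have "(f has_vector_derivative velocity f t) (at t)"
        using that by (auto simp: N_def vector_derivative_works)
      then have "((\<lambda>y. v \<bullet> f y) has_derivative (\<lambda>h. v \<bullet> (h *\<^sub>R velocity f t))) (at t)"
        unfolding has_vector_derivative_def by (rule has_derivative_inner_right)
      then show ?thesis
        using \<open>\<epsilon> > 0\<close> unfolding has_derivative_at_alt
        by (auto simp: inner_diff_right)
    qed
    then obtain d where d: "\<And>t. t \<in> {a..b} - N \<Longrightarrow> d t > 0"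
      "\<And>t y. t \<in> {a..b} - N \<Longrightarrow> \<bar>y - t\<bar> < d t \<Longrightarrow> 
            \<bar>v \<bullet> (f y - f t) - (y - t) * (v \<bullet> velocity f t)\<bar> \<le> \<epsilon> * \<bar>y - t\<bar>"
      by metis
    define \<gamma> where "\<gamma> t = (if t \<in> N then V else if t \<in> {a..b} then ball t (d t) else UNIV)" for t
    have "gauge \<gamma>"
      using V d(1) by (auto simp: \<gamma>_def gauge_def)
    then obtain p where p: "p tagged_division_of {a..b}" "\<gamma> fine p"
      using fine_division_exists_real by blast
    define q where "q = {(t, k) \<in> p. t \<in> N}"
    have "finite p"
      using p(1) by blast
    have q: "q tagged_partial_division_of {a..b}"
      using tagged_partial_division_subset[of p "{a..b}" q] p(1)
      by (auto simp: q_def tagged_division_of_def)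
    have interval: "t \<in> k \<and> k = {Inf k..Sup k} \<and> Inf k \<le> t \<and> t \<le> Sup k \<and> k \<subseteq> {a..b}"
      if tk: "(t, k) \<in> p" for t k
    proof -
      obtain u w where "k = cbox u w" "t \<in> k" "k \<subseteq> {a..b}"
        using tagged_division_ofD(2)[OF p(1) tk] tagged_division_ofD(3)[OF p(1) tk] 
          tagged_division_ofD(4)[OF p(1) tk] by metis
      then show ?thesis
        by auto
    qed
    have div: "snd ` q division_of \<Union> (snd ` q)"
      by (rule partial_division_of_tagged_division[OF q])
    have sub: "\<Union> (snd ` q) \<subseteq> {a..b}" "\<Union> (snd ` q) \<subseteq> V"
      using interval p(2) by (fastforce simp: q_def fine_def \<gamma>_def)+
    have "(\<Sum>k\<in>snd ` q. Sup k - Inf k) = (\<Sum>k\<in>snd ` q. measure lebesgue k)"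
    proof (rule sum.cong)
      fix k assume "k \<in> snd ` q"
      then have "k = {Inf k..Sup k}" "Inf k \<le> Sup k"
        using interval by (fastforce simp: q_def)+
      then show "Sup k - Inf k = measure lebesgue k"
        by (metis measure_completion measure_lborel_Icc atLeastAtMost_borel sets_lborel)
    qed simp
    also have "\<dots> = measure lebesgue (\<Union> (snd ` q))"
      by (rule content_division[OF div])
    also have "\<dots> \<le> measure lebesgue V"
      using sub(2) V(3) lmeasurable_division[OF div] by (intro measure_mono_fmeasurable) auto
    also have "\<dots> < \<eta>"
      by (rule V)
    finally have small: "(\<Sum>k\<in>snd ` q. norm (f (Sup k) - f (Inf k))) < \<epsilon>"
      using \<eta>[OF div sub(1)] by blast
    have ne: "(t, {}) \<notin> p" for t
      using interval by blast
    \<comment> \<open>The passage from tagged pairs to intervals is made for summands that vanish on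
      intervals without interior. One-point intervals comply; at the empty one
      \<open>f (Sup k) - f (Inf k)\<close> need not vanish, hence the case distinction.\<close>
    let ?w = "\<lambda>k. if k = {} then 0 else norm (f (Sup k) - f (Inf k))"
    have "(\<Sum>(t, k)\<in>q. norm (f (Sup k) - f (Inf k))) = (\<Sum>(t, k)\<in>q. ?w k)"
      using ne by (intro sum.cong) (auto simp: q_def)
    also have "\<dots> = (\<Sum>k\<in>snd ` q. ?w k)"
    proof (rule sum.over_tagged_division_lemma[OF tagged_partial_division_of_Union_self[OF q]])
      fix u w :: real
      assume "box u w = {}"
      then have "w \<le> u"
        by simp
      then consider "cbox u w = {}" | "cbox u w = {u}"
        by (cases "w = u") auto
      then show "?w (cbox u w) = 0"
      proof cases
        case 1
        show ?thesis
          unfolding 1 by simp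
      next
        case 2
        show ?thesis
          unfolding 2 by simp
      qed
    qed
    also have "\<dots> = (\<Sum>k\<in>snd ` q. norm (f (Sup k) - f (Inf k)))"
      using ne by (intro sum.cong) (auto simp: q_def)
    finally have sum_q: "(\<Sum>(t, k)\<in>q. norm (f (Sup k) - f (Inf k))) = (\<Sum>k\<in>snd ` q. norm (f (Sup k) - f (Inf k)))" .
    have local: "v \<bullet> (f (Sup k) - f (Inf k)) \<le> (M + \<epsilon>) * (Sup k - Inf k)
        + (if t \<in> N then norm v * norm (f (Sup k) - f (Inf k)) else 0)" if tk: "(t, k) \<in> p" for t k
    proof (cases "t \<in> N")
      case True
      \<comment> \<open>Here \<open>0 \<le> M\<close> is used: an interval tagged in
        \<open>N\<close> still carries the linear term, which must not be negative.\<close>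
      have "0 \<le> (M + \<epsilon>) * (Sup k - Inf k)"
        using interval[OF tk] \<open>\<epsilon> > 0\<close> \<open>0 \<le> M\<close> by (intro mult_nonneg_nonneg) auto
      then show ?thesis
        using True norm_cauchy_schwarz[of v "f (Sup k) - f (Inf k)"] by auto
    next
      case False
      have t: "t \<in> {a..b} - N" and le: "Inf k \<le> t" "t \<le> Sup k" and "Inf k \<in> k" "Sup k \<in> k"
        using False interval[OF tk] by (blast, blast, blast, (metis atLeastAtMost_iff order_refl order_trans)+)
      moreover have "k \<subseteq> ball t (d t)"
        using fineD[OF p(2) tk] t by (simp add: \<gamma>_def)
      ultimately have near: "\<bar>Inf k - t\<bar> < d t" "\<bar>Sup k - t\<bar> < d t"
        by (auto simp: dist_real_def abs_minus_commute)
      have vM: "v \<bullet> velocity f t \<le> M"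
        using t by (auto simp: N_def)
      have "v \<bullet> (f (Sup k) - f t) \<le> (Sup k - t) * (v \<bullet> velocity f t) + \<epsilon> * (Sup k - t)"
        using d(2)[OF t near(2)] le by auto
      also have "\<dots> \<le> (Sup k - t) * M + \<epsilon> * (Sup k - t)"
        using mult_left_mono[OF vM, of "Sup k - t"] le by auto
      finally have 1: "v \<bullet> (f (Sup k) - f t) \<le> (M + \<epsilon>) * (Sup k - t)"
        by (simp add: algebra_simps)
      have "v \<bullet> (f t - f (Inf k)) \<le> (t - Inf k) * (v \<bullet> velocity f t) + \<epsilon> * (t - Inf k)"
        using d(2)[OF t near(1)] le by (auto simp: inner_diff_right algebra_simps)
      also have "\<dots> \<le> (t - Inf k) * M + \<epsilon> * (t - Inf k)"
        using mult_left_mono[OF vM, of "t - Inf k"] le by auto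
      finally have 2: "v \<bullet> (f t - f (Inf k)) \<le> (M + \<epsilon>) * (t - Inf k)"
        by (simp add: algebra_simps)
      show ?thesis
        using 1 2 False by (simp add: inner_diff_right algebra_simps)
    qed
    have "v \<bullet> (f b - f a) = (\<Sum>(t, k)\<in>p. v \<bullet> f (Sup k) - v \<bullet> f (Inf k))"
      using additive_tagged_division_1[OF \<open>a \<le> b\<close> p(1), of "\<lambda>t. v \<bullet> f t"] by (simp add: inner_diff_right)
    also have "\<dots> \<le> (\<Sum>(t, k)\<in>p. (M + \<epsilon>) * (Sup k - Inf k)
        + (if t \<in> N then norm v * norm (f (Sup k) - f (Inf k)) else 0))"
      using local by (intro sum_mono) (simp add: inner_diff_right split_beta)
    also have "\<dots> = (M + \<epsilon>) * (\<Sum>(t, k)\<in>p. Sup k - Inf k)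
        + (\<Sum>(t, k)\<in>p. if t \<in> N then norm v * norm (f (Sup k) - f (Inf k)) else 0)"
      by (simp add: sum.distrib sum_distrib_left case_prod_unfold)
    also have "(\<Sum>(t, k)\<in>p. Sup k - Inf k) = b - a"
      using additive_tagged_division_1[OF \<open>a \<le> b\<close> p(1), of "\<lambda>t. t"] by simp
    also have "(\<Sum>(t, k)\<in>p. if t \<in> N then norm v * norm (f (Sup k) - f (Inf k)) else 0)
        = (\<Sum>(t, k)\<in>q. norm v * norm (f (Sup k) - f (Inf k)))"
      using \<open>finite p\<close> by (intro sum.mono_neutral_cong_right) (auto simp: q_def split: if_splits)
    also have "\<dots> = norm v * (\<Sum>(t, k)\<in>q. norm (f (Sup k) - f (Inf k)))"
      by (simp add: sum_distrib_left case_prod_unfold)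
    also have "\<dots> \<le> norm v * \<epsilon>"
      using small sum_q by (intro mult_left_mono) auto
    finally show ?thesis
      by simp
  qed
  \<comment> \<open>The summand 1 keeps \<open>K\<close> positive when \<open>a = b\<close> and
    \<open>v = 0\<close>.\<close>
  define K where "K = (b - a) + norm v + 1"
  have "K > 0"
    using \<open>a \<le> b\<close> by (simp add: K_def add_nonneg_pos)
  show ?thesis
  proof (rule field_le_epsilon)
    fix e :: real assume "e > 0"
    define \<epsilon> where "\<epsilon> = e / K"
    have "\<epsilon> > 0" "\<epsilon> * K = e"
      using \<open>e > 0\<close> \<open>K > 0\<close> by (auto simp: \<epsilon>_def)
    then have "v \<bullet> (f b - f a) \<le> (M + \<epsilon>) * (b - a) + norm v * \<epsilon>"
      by (intro bound)
    also have "\<dots> = M * (b - a) + \<epsilon> * (b - a + norm v)"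
      by (simp add: algebra_simps)
    also have "\<dots> \<le> M * (b - a) + \<epsilon> * K"
      using \<open>\<epsilon> > 0\<close> by (intro add_left_mono mult_left_mono) (auto simp: K_def)
    finally show "v \<bullet> (f b - f a) \<le> M * (b - a) + e"
      using \<open>\<epsilon> * K = e\<close> by simp
  qed
qed

section \<open>Normal cones of polyhedra\<close>

definition polyhedron_of :: "'i set \<Rightarrow> ('i \<Rightarrow> 'a::real_inner) \<Rightarrow> ('i \<Rightarrow> real) \<Rightarrow> 'a set" where
  "polyhedron_of J a c = {x. \<forall>j\<in>J. a j \<bullet> x \<le> c j}"

definition active_constraints :: "'i set \<Rightarrow> ('i \<Rightarrow> 'a::real_inner) \<Rightarrow> ('i \<Rightarrow> real) \<Rightarrow> 'a \<Rightarrow> 'i set" where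
  "active_constraints J a c x = {j \<in> J. a j \<bullet> x = c j}"

lemma zero_in_normal_cone: "x \<in> C \<Longrightarrow> 0 \<in> normal_cone C x"
  by (simp add: normal_cone_def)

lemma closed_normal_cone: "closed (normal_cone C x)"
proof (cases "x \<in> C")
  case True
  then have "normal_cone C x = (\<Inter>y\<in>C. {v. (y - x) \<bullet> v \<le> 0})"
    by (auto simp: normal_cone_def inner_commute)
  then show ?thesis
    by (simp add: closed_INT closed_halfspace_le)
qed (simp add: normal_cone_def)

text \<open>A vector is normal at \<open>x\<close> when \<open>x\<close> maximizes its inner product
  over \<open>C\<close>; a point of \<open>C\<close> that does at least as well is a maximizer too.
  This turns persistence of a normal into a sign condition on a scalar gap.\<close>

lemma normal_cone_transfer:
  assumes "v \<in> normal_cone C x" "y \<in> C" "v \<bullet> (x - y) \<le> 0"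
  shows "v \<in> normal_cone C y"
proof -
  have "v \<bullet> (z - y) \<le> 0" if "z \<in> C" for z
  proof -
    have "v \<bullet> (z - x) \<le> 0"
      using assms(1) that by (auto simp: normal_cone_def split: if_splits)
    then show ?thesis
      using assms(3) by (simp add: inner_diff_right)
  qed
  then show ?thesis
    using assms(2) by (simp add: normal_cone_def)
qed

text \<open>For \<open>z\<close> in the polyhedron, the direction \<open>z - y\<close> respects
  every constraint active at \<open>y\<close>, hence every one active at \<open>x\<close>. A short
  step from \<open>x\<close> along it therefore stays inside, and testing \<open>v\<close> there
  gives the inequality at \<open>y\<close>.\<close>

lemma normal_cone_subset_if_active_subset:
  assumes "finite J" and x: "x \<in> polyhedron_of J a c" and y: "y \<in> polyhedron_of J a c"
    and sub: "active_constraints J a c x \<subseteq> active_constraints J a c y"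
  shows "normal_cone (polyhedron_of J a c) x \<subseteq> normal_cone (polyhedron_of J a c) y"
proof
  fix v assume v: "v \<in> normal_cone (polyhedron_of J a c) x"
  have "v \<bullet> (z - y) \<le> 0" if z: "z \<in> polyhedron_of J a c" for z
  proof -
    have "\<forall>\<^sub>F e in at_right 0. a j \<bullet> (x + e *\<^sub>R (z - y)) \<le> c j" if "j \<in> J" for j
    proof (cases "a j \<bullet> x = c j")
      case True
      then have "a j \<bullet> y = c j"
        using sub that by (auto simp: active_constraints_def)
      then have "a j \<bullet> (z - y) \<le> 0"
        using z that by (auto simp: polyhedron_of_def inner_diff_right)
      then have "a j \<bullet> (x + e *\<^sub>R (z - y)) \<le> c j" if "e > 0" for e
        using True that by (simp add: inner_add_right mult_nonneg_nonpos)
      then show ?thesis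
        by (auto simp: eventually_at_right_field intro!: exI[of _ 1])
    next
      case False
      then have "a j \<bullet> x < c j"
        using x that by (force simp: polyhedron_of_def)
      moreover have "((\<lambda>e. a j \<bullet> (x + e *\<^sub>R (z - y))) \<longlongrightarrow> a j \<bullet> (x + 0 *\<^sub>R (z - y))) (at_right 0)"
        by (intro tendsto_intros)
      ultimately have "\<forall>\<^sub>F e in at_right 0. a j \<bullet> (x + e *\<^sub>R (z - y)) < c j"
        by (intro order_tendstoD) auto
      then show ?thesis
        by (rule eventually_mono) auto
    qed
    then have "\<forall>\<^sub>F e in at_right (0::real). \<forall>j\<in>J. a j \<bullet> (x + e *\<^sub>R (z - y)) \<le> c j"
      using \<open>finite J\<close> by (intro eventually_ball_finite) auto
    then have "\<forall>\<^sub>F e in at_right (0::real). x + e *\<^sub>R (z - y) \<in> polyhedron_of J a c \<and> e > 0"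
      using eventually_at_right_less[of "0::real"] by eventually_elim (auto simp: polyhedron_of_def)
    then obtain e :: real where "x + e *\<^sub>R (z - y) \<in> polyhedron_of J a c" "e > 0"
      using eventually_happens'[OF trivial_limit_at_right_real] by blast
    moreover have "v \<bullet> (w - x) \<le> 0" if "w \<in> polyhedron_of J a c" for w
      using v x that by (simp add: normal_cone_def)
    from this[OF calculation(1)] have "e * (v \<bullet> (z - y)) \<le> 0"
      by simp
    ultimately show ?thesis
      by (simp add: mult_le_0_iff)
  qed
  then show "v \<in> normal_cone (polyhedron_of J a c) y"
    using y by (simp add: normal_cone_def)
qed

text \<open>The cone at a point depends only on the set of active constraints, of which there are
  finitely many.\<close>

lemma finite_normal_cones:
  assumes "finite J"
  shows "finite (normal_cone (polyhedron_of J a c) ` polyhedron_of J a c)"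
proof -
  let ?C = "polyhedron_of J a c" and ?A = "active_constraints J a c"
  define F where "F A = normal_cone ?C (SOME x. x \<in> ?C \<and> ?A x = A)" for A
  have "normal_cone ?C x = F (?A x)" if "x \<in> ?C" for x
  proof -
    define y where "y = (SOME y. y \<in> ?C \<and> ?A y = ?A x)"
    have "y \<in> ?C \<and> ?A y = ?A x"
      unfolding y_def using that by (intro someI[of "\<lambda>y. y \<in> ?C \<and> ?A y = ?A x" x]) auto
    then have "normal_cone ?C x = normal_cone ?C y"
      using normal_cone_subset_if_active_subset[OF assms] that by (metis order_refl subset_antisym)
    then show ?thesis
      by (simp add: F_def y_def)
  qed
  moreover have "?A x \<in> Pow J" for x
    by (auto simp: active_constraints_def)
  ultimately have "normal_cone ?C ` ?C \<subseteq> F ` Pow J"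
    by blast
  then show ?thesis
    using assms by (meson finite_Pow_iff finite_imageI finite_subset)
qed

text \<open>Strict inequalities survive small perturbations, so no new constraint becomes active
  near \<open>x\<close>.\<close>

lemma eventually_normal_cone_subset:
  assumes "finite J" "x \<in> polyhedron_of J a c"
  shows "\<forall>\<^sub>F y in nhds x. y \<in> polyhedron_of J a c \<longrightarrow>
    normal_cone (polyhedron_of J a c) y \<subseteq> normal_cone (polyhedron_of J a c) x"
proof -
  have "\<forall>\<^sub>F y in nhds x. a j \<bullet> x < c j \<longrightarrow> a j \<bullet> y < c j" for j
  proof (cases "a j \<bullet> x < c j")
    case True
    have "((\<lambda>y. a j \<bullet> y) \<longlongrightarrow> a j \<bullet> x) (nhds x)"
      by (intro tendsto_intros filterlim_ident)
    then have "\<forall>\<^sub>F y in nhds x. a j \<bullet> y < c j"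
      using True by (rule order_tendstoD)
    then show ?thesis
      by (rule eventually_mono) auto
  qed simp
  then have "\<forall>\<^sub>F y in nhds x. \<forall>j\<in>J. a j \<bullet> x < c j \<longrightarrow> a j \<bullet> y < c j"
    using assms(1) by (intro eventually_ball_finite) auto
  then show ?thesis
  proof eventually_elim
    case (elim y)
    have "active_constraints J a c y \<subseteq> active_constraints J a c x"
      using elim assms(2) by (force simp: active_constraints_def polyhedron_of_def)
    then show ?case
      using normal_cone_subset_if_active_subset[OF assms(1) _ assms(2)] by blast
  qed
qed

section \<open>Velocities and normals along a trajectory\<close>

lemma normal_cone_orthogonal_velocity:
  fixes x :: "real \<Rightarrow> 'a::real_inner"
  assumes diff: "x differentiable (at t)" and t: "t \<in> {a<..<b}"
    and C: "\<And>s. s \<in> {a..b} \<Longrightarrow> x s \<in> C" and n: "n \<in> normal_cone C (x t)"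
  shows "n \<bullet> velocity x t = 0"
proof -
  have "(x has_vector_derivative velocity x t) (at t)"
    using diff by (simp add: vector_derivative_works)
  then have "((\<lambda>s. n \<bullet> x s) has_derivative (\<lambda>h. n \<bullet> (h *\<^sub>R velocity x t))) (at t)"
    unfolding has_vector_derivative_def by (rule has_derivative_inner_right)
  then have D: "((\<lambda>s. n \<bullet> x s) has_real_derivative n \<bullet> velocity x t) (at t)"
    by (simp add: has_field_derivative_def mult_commute_abs)
  \<comment> \<open>A normal at \<open>x t\<close> makes \<open>n \<bullet> x s\<close> maximal at
    the interior time \<open>t\<close>, so its derivative vanishes there.\<close>
  have max: "n \<bullet> x s \<le> n \<bullet> x t" if "s \<in> {a..b}" for s
  proof -
    have "n \<bullet> (x s - x t) \<le> 0"
      using n C[OF that] by (auto simp: normal_cone_def split: if_splits)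
    then show ?thesis
      by (simp add: inner_diff_right)
  qed
  show ?thesis
  proof (rule DERIV_local_max[OF D, of "min (t - a) (b - t)"])
    show "\<forall>s. \<bar>t - s\<bar> < min (t - a) (b - t) \<longrightarrow> n \<bullet> x s \<le> n \<bullet> x t"
      using max by (auto simp: abs_if split: if_splits)
  qed (use t in auto)
qed

lemma AE_lebesgue_on_subset:
  assumes "AE t in lebesgue_on A. P t" "B \<subseteq> A" "A \<in> sets lebesgue" "B \<in> sets lebesgue"
  shows "AE t in lebesgue_on B. P t"
proof -
  have "AE t in lebesgue. t \<in> A \<longrightarrow> P t"
    using assms by (subst (asm) AE_restrict_space_iff) auto
  then have "AE t in lebesgue. t \<in> B \<longrightarrow> P t"
    using assms(2) by (auto elim!: eventually_mono)
  then show ?thesis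
    using assms by (subst AE_restrict_space_iff) auto
qed

lemma AE_lebesgue_on_interior:
  "AE t in lebesgue_on {a..b::real}. t \<in> {a<..<b}"
proof -
  have "AE t in lebesgue. t \<noteq> a" "AE t in lebesgue. t \<noteq> b"
    by (auto intro!: AE_completion AE_lborel_singleton)
  then have "AE t in lebesgue. t \<in> {a..b} \<longrightarrow> t \<in> {a<..<b}"
    by eventually_elim auto
  then show ?thesis
    by (subst AE_restrict_space_iff) auto
qed

lemma lipschitz_on_sweeping_trajectory:
  fixes x :: "real \<Rightarrow> 'a::real_inner"
  assumes ac: "abs_continuous_on x a b" and C: "\<And>t. t \<in> {a..b} \<Longrightarrow> x t \<in> C" and "0 \<le> M"
    and sweep: "AE t in lebesgue_on {a..b}. x differentiable (at t) \<and>
      - velocity x t - f t \<in> normal_cone C (x t) \<and> norm (f t) \<le> M"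
  shows "M-lipschitz_on {a..b} x" and "AE t in lebesgue_on {a..b}. norm (velocity x t) \<le> M"
proof -
  have *: "AE t in lebesgue_on {a..b}. x differentiable (at t) \<and> norm (velocity x t) \<le> M"
    using sweep AE_lebesgue_on_interior
  proof eventually_elim
    case (elim t)
    have "(- velocity x t - f t) \<bullet> velocity x t = 0"
      using elim normal_cone_orthogonal_velocity[of x t a b C] C by blast
    then have "(norm (velocity x t))\<^sup>2 = - f t \<bullet> velocity x t"
      by (simp add: power2_norm_eq_inner inner_diff_left)
    also have "\<dots> \<le> norm (f t) * norm (velocity x t)"
      using norm_cauchy_schwarz[of "- f t" "velocity x t"] by simp
    also have "\<dots> \<le> M * norm (velocity x t)"
      using elim by (simp add: mult_right_mono)
    finally have "norm (velocity x t) * norm (velocity x t) \<le> M * norm (velocity x t)"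
      by (simp add: power2_eq_square)
    then have "norm (velocity x t) \<le> M"
      using \<open>0 \<le> M\<close> by (metis mult_right_le_imp_le norm_ge_zero order_le_less)
    then show ?case
      using elim by simp
  qed
  then show "AE t in lebesgue_on {a..b}. norm (velocity x t) \<le> M"
    by (rule AE_mp) auto
  have le: "norm (x d - x c) \<le> M * (d - c)" if "a \<le> c" "c \<le> d" "d \<le> b" for c d
  proof -
    \<comment> \<open>Testing with the unit vector along the increment reduces the vector estimate
      to the scalar one; \<open>sgn 0 = 0\<close> covers equal endpoints.\<close>
    let ?v = "sgn (x d - x c)"
    have "AE t in lebesgue_on {c..d}. x differentiable (at t) \<and> norm (velocity x t) \<le> M"
      by (rule AE_lebesgue_on_subset[OF *]) (use that in auto)
    moreover have "?v \<bullet> velocity x t \<le> norm (velocity x t)" for t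
      using norm_cauchy_schwarz[of ?v "velocity x t"] by (auto simp: norm_sgn split: if_splits)
    ultimately have "AE t in lebesgue_on {c..d}. x differentiable (at t) \<and> ?v \<bullet> velocity x t \<le> M"
      by (elim eventually_mono) (use order_trans in blast)
    then have "?v \<bullet> (x d - x c) \<le> M * (d - c)"
      using abs_continuous_on_subinterval[OF ac] that \<open>0 \<le> M\<close>
      by (intro abs_continuous_on_increment_le) auto
    moreover have "?v \<bullet> (x d - x c) = norm (x d - x c)"
      by (cases "x d = x c") (simp_all add: sgn_div_norm dot_square_norm power2_eq_square)
    ultimately show ?thesis
      by simp
  qed
  show "M-lipschitz_on {a..b} x"
  proof (rule lipschitz_onI)
    fix s t assume "s \<in> {a..b}" "t \<in> {a..b}"
    then show "dist (x s) (x t) \<le> M * dist s t"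
      using le[of s t] le[of t s] by (cases "s \<le> t") (auto simp: dist_norm norm_minus_commute)
  qed fact
qed


text \<open>
  If \<open>v\<close> left the normal cone, the nonnegative gap \<open>v \<bullet> (x t - x s)\<close> would have to become positive.
  By orthogonality of normals and velocities its derivative is
  \<open>-\<bar>n - v\<bar>\<^sup>2 + (n - v) \<bullet> (f t - f s)\<close> with \<open>n\<close> the normal selected at \<open>s\<close>, and \<open>\<bar>n - v\<bar>\<close> is bounded below
  because a polyhedron has only finitely many normal cones.
\<close>

lemma sweeping_normal_persists:
  fixes x :: "real \<Rightarrow> 'a::euclidean_space"
  assumes "finite J" and C_eq: "C = polyhedron_of J p c"
    and ac: "abs_continuous_on x a b" and cont: "continuous_on {a..b} x"
    and C: "\<And>s. s \<in> {a..b} \<Longrightarrow> x s \<in> C"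
    and sweep: "AE s in lebesgue_on {a..b}. x differentiable (at s) \<and> - velocity x s - f s \<in> normal_cone C (x s)"
    and t: "t \<in> {a<..<b}" and diff: "x differentiable (at t)"
    and v: "v = - velocity x t - f t" "v \<in> normal_cone C (x t)"
    and f: "(f \<longlongrightarrow> f t) (at_right t)"
  shows "\<forall>\<^sub>F s in at_right t. v \<in> normal_cone C (x s)"
proof -
  have "\<forall>N\<in>{N \<in> normal_cone C ` C. v \<notin> N}. \<exists>k>0. \<forall>n\<in>N. k \<le> norm (n - v)"
  proof safe
    fix y assume "v \<notin> normal_cone C y"
    then show "\<exists>k>0. \<forall>n\<in>normal_cone C y. k \<le> norm (n - v)"
      using separate_point_closed[OF closed_normal_cone] by (metis dist_commute dist_norm)
  qed
  then obtain k where k: "\<And>N. N \<in> normal_cone C ` C \<Longrightarrow> v \<notin> N \<Longrightarrow> k N > 0 \<and> (\<forall>n\<in>N. k N \<le> norm (n - v))"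
    by (metis (mono_tags, lifting) mem_Collect_eq)
  \<comment> \<open>Each cone that misses \<open>v\<close> is closed, hence at a positive distance
    from \<open>v\<close>; finiteness makes the minimum positive. The extra 1 keeps the set nonempty
    if no cone misses \<open>v\<close>.\<close>
  define \<kappa> where "\<kappa> = Min (insert 1 (k ` {N \<in> normal_cone C ` C. v \<notin> N}))"
  have fin: "finite (normal_cone C ` C)"
    unfolding C_eq by (rule finite_normal_cones[OF \<open>finite J\<close>])
  have "\<kappa> > 0"
    using fin k by (auto simp: \<kappa>_def)
  have \<kappa>: "\<kappa> \<le> norm (n - v)" if "y \<in> C" "v \<notin> normal_cone C y" "n \<in> normal_cone C y" for n y
  proof -
    have "\<kappa> \<le> k (normal_cone C y)"
      unfolding \<kappa>_def using that fin by (intro Min_le) auto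
    then show ?thesis
      using k[of "normal_cone C y"] that by force
  qed
  have "(x \<longlongrightarrow> x t) (at_right t)"
    using continuous_on_interior[OF cont, of t] t by (simp add: isCont_def filterlim_at_split)
  then have "\<forall>\<^sub>F s in at_right t. x s \<in> C \<longrightarrow> normal_cone C (x s) \<subseteq> normal_cone C (x t)"
    using eventually_normal_cone_subset[OF \<open>finite J\<close>, of "x t" p c] C[of t] t
    unfolding C_eq filterlim_iff by auto
  moreover have "\<forall>\<^sub>F s in at_right t. norm (f s - f t) < \<kappa>"
    using tendstoD[OF f \<open>\<kappa> > 0\<close>] by (simp add: dist_norm)
  moreover have "\<forall>\<^sub>F s in at_right t. s < b"
    using t eventually_at_right_field by auto
  ultimately have "\<forall>\<^sub>F s in at_right t. s < b \<and> normal_cone C (x s) \<subseteq> normal_cone C (x t) \<and> norm (f s - f t) < \<kappa>"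
    using eventually_at_right_less[of t] by eventually_elim (use C t in auto)
  then obtain d where "d > t" and d: "\<And>s. s \<in> {t<..<d} \<Longrightarrow>
      s < b \<and> normal_cone C (x s) \<subseteq> normal_cone C (x t) \<and> norm (f s - f t) < \<kappa>"
    by (auto simp: eventually_at_right_field)
  have vw: "n \<bullet> velocity x t = 0" if "n \<in> normal_cone C (x t)" for n
    using normal_cone_orthogonal_velocity[OF diff t C that] by blast
  have descent: "- v \<bullet> velocity x s \<le> 0"
    if s: "s \<in> {t<..<d}" and pos: "v \<bullet> (x t - x s) > 0" and "x differentiable (at s)"
      and n: "- velocity x s - f s \<in> normal_cone C (x s)" for s
  proof -
    define n where "n = - velocity x s - f s"
    define e where "e = f t - f s"
    have s': "s \<in> {a<..<b}" "x s \<in> C" "x t \<in> C"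
      using C[of s] C[of t] d[OF s] s t by auto
    have nC: "n \<in> normal_cone C (x s)" "n \<in> normal_cone C (x t)"
      using n d[OF s] by (auto simp: n_def)
    \<comment> \<open>The point \<open>x t\<close> of \<open>C\<close> has a larger inner product
      with \<open>v\<close> than \<open>x s\<close>.\<close>
    have "v \<notin> normal_cone C (x s)"
      using pos s'(2,3) unfolding normal_cone_def by (metis (mono_tags, lifting) mem_Collect_eq not_le)
    then have "\<kappa> \<le> norm (n - v)"
      using \<kappa> s' nC by blast
    have nx: "n \<bullet> velocity x s = 0"
      using normal_cone_orthogonal_velocity[of x s a b C n] s' nC that C by blast
    have "e = n - v + velocity x s - velocity x t"
      by (simp add: e_def n_def v(1))
    \<comment> \<open>The cones having shrunk, \<open>n\<close> is normal at \<open>x s\<close> and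
      at \<open>x t\<close>, so it is orthogonal to both velocities, while \<open>v\<close> is
      orthogonal to the one at \<open>t\<close>. Pairing \<open>e\<close> with \<open>n - v\<close>
      thus leaves only \<open>- v \<bullet> velocity x s\<close> besides the square.\<close>
    then have "- v \<bullet> velocity x s = - ((n - v) \<bullet> (n - v)) + (n - v) \<bullet> e"
      using nx vw[OF nC(2)] vw[OF v(2)]
      by (simp add: inner_diff_left inner_diff_right inner_add_right)
    also have "\<dots> \<le> - (norm (n - v))\<^sup>2 + norm (n - v) * norm e"
      using norm_cauchy_schwarz[of "n - v" e] by (simp add: power2_norm_eq_inner)
    also have "\<dots> = norm (n - v) * (norm e - norm (n - v))"
      by (simp add: power2_eq_square algebra_simps)
    also have "\<dots> \<le> 0"
      using \<open>\<kappa> \<le> norm (n - v)\<close> d[OF s] by (intro mult_nonneg_nonpos) (auto simp: e_def norm_minus_commute)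
    finally show ?thesis .
  qed
  have "v \<in> normal_cone C (x s)" if s: "s \<in> {t<..<d}" for s
  proof -
    have sb: "s < b" "x s \<in> C"
      using d[OF s] C[of s] s t by auto
    have "v \<bullet> (x t - x s) \<le> 0"
    proof (rule ccontr)
      assume "\<not> ?thesis"
      then have pos: "v \<bullet> (x t - x s) > 0"
        by simp
      \<comment> \<open>Let \<open>r\<close> be the last zero of the gap in \<open>{t..s}\<close>.
        Beyond it the gap is positive by the intermediate value theorem, so the descent estimate
        holds almost everywhere on \<open>{r..s}\<close> and the gap cannot climb from 0.\<close>
      define Z where "Z = {r \<in> {t..s}. v \<bullet> (x t - x r) = 0}"
      have contt: "continuous_on {t..s} (\<lambda>r. v \<bullet> (x t - x r))"
        by (intro continuous_intros continuous_on_subset[OF cont]) (use t sb in auto)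
      have "closed Z"
        unfolding Z_def using continuous_closed_preimage_constant[OF contt, of 0] by auto
      moreover have "Z \<subseteq> {t..s}"
        by (auto simp: Z_def)
      ultimately have "compact Z"
        using bounded_subset[of "{t..s}" Z] by (simp add: compact_eq_bounded_closed)
      moreover have "t \<in> Z"
        using s by (auto simp: Z_def)
      ultimately obtain r where r: "r \<in> Z" "\<And>q. q \<in> Z \<Longrightarrow> q \<le> r"
        using compact_attains_sup[of Z] by blast
      have rs: "t \<le> r" "r \<le> s" and r0: "v \<bullet> (x t - x r) = 0"
        using r(1) by (auto simp: Z_def)
      have pos_after: "v \<bullet> (x t - x q) > 0" if q: "q \<in> {r<..s}" for q
      proof (rule ccontr)
        assume "\<not> ?thesis"
        then obtain z where "q \<le> z" "z \<le> s" "v \<bullet> (x t - x z) = 0"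
          using q pos rs IVT'[of "\<lambda>r. v \<bullet> (x t - x r)" q 0 s] by (force intro: continuous_on_subset[OF contt])
        then show False
          using r(2)[of z] q rs by (auto simp: Z_def)
      qed
      have "AE q in lebesgue_on {r..s}. x differentiable (at q) \<and> - velocity x q - f q \<in> normal_cone C (x q)"
        by (rule AE_lebesgue_on_subset[OF sweep]) (use t rs sb in auto)
      then have "AE q in lebesgue_on {r..s}. x differentiable (at q) \<and> - v \<bullet> velocity x q \<le> 0"
        using AE_lebesgue_on_interior
      proof eventually_elim
        case (elim q)
        then show ?case
          using descent[of q] pos_after[of q] s rs by auto
      qed
      then have "- v \<bullet> (x s - x r) \<le> 0 * (s - r)"
        using rs t sb by (intro abs_continuous_on_increment_le abs_continuous_on_subinterval[OF ac]) auto
      then show False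
        using pos r0 by (simp add: inner_diff_right)
    qed
    then show ?thesis
      using normal_cone_transfer v(2) sb(2) by blast
  qed
  then show ?thesis
    using \<open>d > t\<close> by (auto simp: eventually_at_right_field)
qed

section \<open>Bounded convergence and dyadic interpolation\<close>

lemma in_L2_bounded:
  fixes f :: "real \<Rightarrow> 'a::euclidean_space"
  assumes "S \<in> lmeasurable" "f \<in> borel_measurable (lebesgue_on S)"
    and "AE t in lebesgue_on S. norm (f t) \<le> B"
  shows "in_L2 S f"
proof -
  interpret finite_measure "lebesgue_on S"
    using assms(1) by (rule finite_measure_lebesgue_on)
  have "integrable (lebesgue_on S) (\<lambda>t. (norm (f t))\<^sup>2)"
  proof (rule integrable_const_bound)
    show "AE t in lebesgue_on S. norm ((norm (f t))\<^sup>2) \<le> B\<^sup>2"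
      using assms(3) by eventually_elim (simp add: power_mono)
  qed (use assms(2) in measurable)
  then show ?thesis
    using assms(2) by (simp add: in_L2_def)
qed

text \<open>Controls, states, velocities and residuals all converge through this form: a common
  bound on a set of finite measure supplies the dominating constant \<open>(2 * B)\<^sup>2\<close>,
  and only pointwise convergence remains to be checked.\<close>

lemma tendsto_L2_bounded:
  fixes f :: "nat \<Rightarrow> real \<Rightarrow> 'a::euclidean_space"
  assumes S: "S \<in> lmeasurable" and meas: "\<And>m. f m \<in> borel_measurable (lebesgue_on S)"
      "g \<in> borel_measurable (lebesgue_on S)"
    and bound: "\<And>m. AE t in lebesgue_on S. norm (f m t) \<le> B" "AE t in lebesgue_on S. norm (g t) \<le> B"
    and lim: "AE t in lebesgue_on S. (\<lambda>m. f m t) \<longlonglongrightarrow> g t"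
  shows "tendsto_L2 S f g"
proof -
  interpret finite_measure "lebesgue_on S"
    using S by (rule finite_measure_lebesgue_on)
  have "(\<lambda>m. LINT t|lebesgue_on S. (norm (f m t - g t))\<^sup>2) \<longlonglongrightarrow> (LINT t|lebesgue_on S. 0)"
  proof (rule integral_dominated_convergence[where w = "\<lambda>_. (2 * B)\<^sup>2"])
    show "AE t in lebesgue_on S. (\<lambda>m. (norm (f m t - g t))\<^sup>2) \<longlonglongrightarrow> 0"
      using lim
    proof eventually_elim
      case (elim t)
      then have "(\<lambda>m. norm (f m t - g t)) \<longlonglongrightarrow> 0"
        by (simp add: LIM_zero tendsto_norm_zero)
      then show ?case
        using tendsto_power[of _ 0 _ 2] by force
    qed
    show "AE t in lebesgue_on S. norm ((norm (f m t - g t))\<^sup>2) \<le> (2 * B)\<^sup>2" for m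
      using bound(1)[of m] bound(2)
    proof eventually_elim
      case (elim t)
      then have "norm (f m t - g t) \<le> 2 * B"
        using norm_triangle_ineq4[of "f m t" "g t"] by linarith
      from power_mono[OF this norm_ge_zero, of 2] show ?case
        by simp
    qed
  qed (use meas in measurable)
  then have "(\<lambda>m. L2_norm S (\<lambda>t. f m t - g t)) \<longlonglongrightarrow> 0"
    using tendsto_real_sqrt by (force simp: L2_norm_def)
  then show ?thesis
    using in_L2_bounded[OF S] meas bound by (auto simp: tendsto_L2_def)
qed

lemma abs_continuous_on_lipschitz:
  assumes "L-lipschitz_on {a..b} f"
  shows "abs_continuous_on f a b"
  unfolding abs_continuous_on_def
proof (intro allI impI)
  fix \<epsilon> :: real assume "\<epsilon> > 0"
  have "L \<ge> 0"
    using assms by (rule lipschitz_on_nonneg)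
  show "\<exists>\<eta>>0. \<forall>d S. d division_of S \<and> S \<subseteq> {a..b} \<and> (\<Sum>k\<in>d. Sup k - Inf k) < \<eta>
        \<longrightarrow> (\<Sum>k\<in>d. norm (f (Sup k) - f (Inf k))) < \<epsilon>"
  \<comment> \<open>\<open>L + 1\<close> in place of \<open>L\<close> avoids division by 0 when
    \<open>L = 0\<close>.\<close>
  proof (intro exI[of _ "\<epsilon> / (L + 1)"] conjI allI impI; (elim conjE)?)
    show "0 < \<epsilon> / (L + 1)"
      using \<open>\<epsilon> > 0\<close> \<open>L \<ge> 0\<close> by simp
    fix d S
    assume d: "d division_of S" and S: "S \<subseteq> {a..b}" and small: "(\<Sum>k\<in>d. Sup k - Inf k) < \<epsilon> / (L + 1)"
    have k: "Inf k \<le> Sup k \<and> Inf k \<in> {a..b} \<and> Sup k \<in> {a..b}" if k: "k \<in> d" for k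
    proof -
      obtain u w where uw: "k = cbox u w"
        using division_ofD(4)[OF d k] by blast
      have "k \<noteq> {}" "k \<subseteq> {a..b}"
        using division_ofD(2,3)[OF d k] S by auto
      then show ?thesis
        by (simp add: uw)
    qed
    have "(\<Sum>k\<in>d. norm (f (Sup k) - f (Inf k))) \<le> (\<Sum>k\<in>d. L * (Sup k - Inf k))"
      using k lipschitz_onD[OF assms] by (intro sum_mono) (fastforce simp: dist_norm)
    also have "\<dots> = L * (\<Sum>k\<in>d. Sup k - Inf k)"
      by (simp add: sum_distrib_left)
    also have "\<dots> \<le> (L + 1) * (\<Sum>k\<in>d. Sup k - Inf k)"
      using k by (intro mult_right_mono sum_nonneg) auto
    also have "\<dots> < \<epsilon>"
      using small \<open>L \<ge> 0\<close> by (simp add: field_simps)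
    finally show "(\<Sum>k\<in>d. norm (f (Sup k) - f (Inf k))) < \<epsilon>" .
  qed
qed

section \<open>The dyadic grid and functions constant on its cells\<close>

definition cell_left :: "real \<Rightarrow> nat \<Rightarrow> real \<Rightarrow> real" where
  "cell_left T m t = of_int \<lfloor>t / (T / 2 ^ m)\<rfloor> * (T / 2 ^ m)"

text \<open>The floor gives both ends for every real \<open>t\<close>, so any function of the two is
  a step function on the grid without case distinctions. At \<open>t = T > 0\<close> they are
  \<open>T\<close> and \<open>T + T / 2 ^ m\<close>, the latter outside the time interval.\<close>

definition cell_right :: "real \<Rightarrow> nat \<Rightarrow> real \<Rightarrow> real" where
  "cell_right T m t = cell_left T m t + T / 2 ^ m"

lemma grid_pt_0 [simp]: "grid_pt T m 0 = 0"
  by (simp add: grid_pt_def)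

lemma grid_pt_top [simp]: "grid_pt T m (2 ^ m) = T"
  by (simp add: grid_pt_def)

lemma grid_pt_mono: "0 < T \<Longrightarrow> i \<le> j \<Longrightarrow> grid_pt T m i \<le> grid_pt T m j"
  by (simp add: grid_pt_def mult_right_mono divide_right_mono)

lemma grid_pt_in_interval:
  assumes "0 < T" "i \<le> 2 ^ m"
  shows "grid_pt T m i \<in> {0..T}"
  using grid_pt_mono[OF assms(1), of 0 i m] grid_pt_mono[OF assms, of m] by simp

lemma grid_pt_diff: "i \<ge> 1 \<Longrightarrow> grid_pt T m i - grid_pt T m (i - 1) = T / 2 ^ m"
  by (cases i) (simp_all add: grid_pt_def distrib_right add_divide_distrib)

lemma cell_left_grid_pt:
  assumes "0 < T"
  shows "cell_left T m (grid_pt T m i) = grid_pt T m i"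
  using assms by (simp add: cell_left_def grid_pt_def)

lemma cell_left_right_grid_cell:
  assumes "0 < T" "i \<ge> 1" "t \<in> grid_cell T m i"
  shows "cell_left T m t = grid_pt T m (i - 1)" "cell_right T m t = grid_pt T m i"
proof -
  define h where "h = T / 2 ^ m"
  have "h > 0"
    using assms(1) by (simp add: h_def)
  have "real (i - 1) * h \<le> t" "t < real i * h"
    using assms(3) by (auto simp: grid_cell_def grid_pt_def h_def)
  then have "real (i - 1) \<le> t / h" "t / h < real (i - 1) + 1"
    using \<open>h > 0\<close> assms(2) by (auto simp: pos_le_divide_eq pos_divide_less_eq of_nat_diff)
  then have "\<lfloor>t / h\<rfloor> = int (i - 1)"
    by (intro floor_unique) auto
  then show l: "cell_left T m t = grid_pt T m (i - 1)"
    by (simp add: cell_left_def grid_pt_def h_def)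
  show "cell_right T m t = grid_pt T m i"
    using grid_pt_diff[OF assms(2), of T m] l by (simp add: cell_right_def)
qed

lemma cell_bounds:
  assumes "0 < T"
  shows "cell_left T m t \<le> t" "t < cell_right T m t"
proof -
  define h where "h = T / 2 ^ m"
  have "h > 0"
    using assms by (simp add: h_def)
  have "of_int \<lfloor>t / h\<rfloor> * h \<le> t" "t < (of_int \<lfloor>t / h\<rfloor> + 1) * h"
    using pos_le_divide_eq[OF \<open>h > 0\<close>, of "of_int \<lfloor>t / h\<rfloor>" t] pos_divide_less_eq[OF \<open>h > 0\<close>, of t "of_int \<lfloor>t / h\<rfloor> + 1"]
      floor_correct[of "t / h"] by simp_all
  then show "cell_left T m t \<le> t" "t < cell_right T m t"
    using \<open>h > 0\<close> by (auto simp: cell_left_def cell_right_def h_def[symmetric] algebra_simps)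
qed

lemma grid_cell_exists:
  assumes "0 < T" "t \<in> {0..<T}"
  obtains i where "i \<in> {1..2 ^ m}" "t \<in> grid_cell T m i"
proof -
  define h where "h = T / 2 ^ m"
  define k where "k = nat \<lfloor>t / h\<rfloor>"
  have "h > 0"
    using assms by (simp add: h_def)
  have "t / h \<ge> 0"
    using assms \<open>h > 0\<close> by simp
  then have k: "real k \<le> t / h" "t / h < real k + 1"
    by (auto simp: k_def)
  have "t / h < 2 ^ m"
    using assms by (simp add: h_def field_simps)
  then have "real k < 2 ^ m"
    using k(1) by linarith
  then have "k < 2 ^ m"
    by simp
  moreover have "t \<in> grid_cell T m (Suc k)"
    using k \<open>h > 0\<close> by (auto simp: grid_cell_def grid_pt_def h_def[symmetric] field_simps)
  ultimately show thesis
    using that[of "Suc k"] by auto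
qed

lemma cell_right_le:
  assumes "0 < T" "t \<in> {0..<T}"
  shows "cell_right T m t \<le> T"
proof -
  obtain i where "i \<in> {1..2 ^ m}" "t \<in> grid_cell T m i"
    using grid_cell_exists[OF assms] .
  then show ?thesis
    using cell_left_right_grid_cell(2)[OF assms(1), of i t m] grid_pt_in_interval[OF assms(1), of i m] by auto
qed

lemma cell_left_nonneg:
  assumes "0 < T" "0 \<le> t"
  shows "0 \<le> cell_left T m t"
  using assms by (simp add: cell_left_def)

lemma tendsto_mesh: "(\<lambda>m. T / 2 ^ m) \<longlonglongrightarrow> (0::real)"
  using tendsto_mult_right_zero[OF LIMSEQ_realpow_zero[of "1/2::real"], of T]
  by (simp add: power_divide)

lemma tendsto_cell_left:
  assumes "0 < T"
  shows "(\<lambda>m. cell_left T m t) \<longlonglongrightarrow> t"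
proof (rule tendsto_sandwich[where f = "\<lambda>m. t - T / 2 ^ m" and h = "\<lambda>_. t"])
  show "(\<lambda>m. t - T / 2 ^ m) \<longlonglongrightarrow> t"
    using tendsto_diff[OF tendsto_const tendsto_mesh, of t T] by simp
qed (use cell_bounds[OF assms, where t = t] in \<open>auto intro!: always_eventually simp: cell_right_def algebra_simps less_imp_le\<close>)

lemma tendsto_cell_right:
  assumes "0 < T"
  shows "(\<lambda>m. cell_right T m t) \<longlonglongrightarrow> t"
  unfolding cell_right_def using tendsto_add[OF tendsto_cell_left[OF assms] tendsto_mesh] by simp

text \<open>Cells are closed on the left and open on the right, so the right end exceeds
  \<open>t\<close> even at a grid point. This turns limits from the right at \<open>t\<close> into
  limits along the grids.\<close>

lemma filterlim_cell_right:
  assumes "0 < T"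
  shows "filterlim (\<lambda>m. cell_right T m t) (at_right t) sequentially"
  using tendsto_cell_right[OF assms] cell_bounds(2)[OF assms] by (auto simp: filterlim_at less_imp_neq[symmetric])

text \<open>The composite factors through the integer index of the cell, and every function on a
  discrete space is measurable. Hence \<open>f\<close> may be arbitrary, for instance a projection
  onto cones that vary with the grid point.\<close>

lemma measurable_cell:
  "(\<lambda>t. f (cell_left T m t) (cell_right T m t)) \<in> borel_measurable (lebesgue_on S)"
proof -
  have "(\<lambda>t. \<lfloor>t / (T / 2 ^ m)\<rfloor>) \<in> borel \<rightarrow>\<^sub>M count_space UNIV"
    by measurable
  then have "(\<lambda>t. \<lfloor>t / (T / 2 ^ m)\<rfloor>) \<in> lebesgue_on S \<rightarrow>\<^sub>M count_space UNIV"
    by (intro measurable_restrict_space1 measurable_completion) simp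
  then show ?thesis
    unfolding cell_left_def cell_right_def
    by (rule measurable_compose[where g = "\<lambda>k. f (of_int k * (T / 2 ^ m)) (of_int k * (T / 2 ^ m) + T / 2 ^ m)"]) simp
qed

section \<open>Difference quotients and piecewise affine interpolation\<close>

lemma tendsto_difference_quotient_straddle:
  fixes x :: "real \<Rightarrow> 'a::real_normed_vector"
  assumes "(x has_vector_derivative w) (at t)"
    and lim: "a \<longlonglongrightarrow> t" "b \<longlonglongrightarrow> t" and le: "\<And>m::nat. a m \<le> t" "\<And>m. t \<le> b m" "\<And>m. a m < b m"
  shows "(\<lambda>m. (x (b m) - x (a m)) /\<^sub>R (b m - a m)) \<longlonglongrightarrow> w"
proof (rule LIMSEQ_I)
  fix e :: real assume "e > 0"
  obtain d where "d > 0" and d: "\<And>y. \<bar>y - t\<bar> < d \<Longrightarrow> norm (x y - x t - (y - t) *\<^sub>R w) \<le> e / 2 * \<bar>y - t\<bar>"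
    using assms(1) \<open>e > 0\<close> unfolding has_vector_derivative_def has_derivative_at_alt
    by (metis half_gt_zero real_norm_def)
  have "\<forall>\<^sub>F m in sequentially. \<bar>a m - t\<bar> < d \<and> \<bar>b m - t\<bar> < d"
    using tendstoD[OF lim(1) \<open>d > 0\<close>] tendstoD[OF lim(2) \<open>d > 0\<close>]
    by eventually_elim (simp add: dist_real_def)
  then have "\<forall>\<^sub>F m in sequentially. norm ((x (b m) - x (a m)) /\<^sub>R (b m - a m) - w) < e"
  proof eventually_elim
    case (elim m)
    define k where "k = b m - a m"
    have "k > 0"
      using le(3)[of m] by (simp add: k_def)
    have "norm ((x (b m) - x (a m)) - k *\<^sub>R w)
        = norm ((x (b m) - x t - (b m - t) *\<^sub>R w) - (x (a m) - x t - (a m - t) *\<^sub>R w))"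
      by (simp add: k_def algebra_simps)
    also have "\<dots> \<le> e / 2 * \<bar>b m - t\<bar> + e / 2 * \<bar>a m - t\<bar>"
      by (rule order_trans[OF norm_triangle_ineq4 add_mono[OF d d]]) (use elim in auto)
    also have "\<dots> = e / 2 * (\<bar>b m - t\<bar> + \<bar>a m - t\<bar>)"
      by (simp add: distrib_left)
    \<comment> \<open>As \<open>t\<close> lies between \<open>a m\<close> and \<open>b m\<close>,
      the two errors are proportional to lengths that add up exactly to the denominator.\<close>
    also have "\<bar>b m - t\<bar> + \<bar>a m - t\<bar> = k"
      using le(1,2)[of m] by (simp add: k_def)
    finally have "norm ((x (b m) - x (a m)) - k *\<^sub>R w) \<le> e / 2 * k" .
    moreover have "(x (b m) - x (a m)) /\<^sub>R k - w = ((x (b m) - x (a m)) - k *\<^sub>R w) /\<^sub>R k"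
      using \<open>k > 0\<close> by (simp add: scaleR_diff_right)
    ultimately have "norm ((x (b m) - x (a m)) /\<^sub>R k - w) \<le> e / 2"
      using \<open>k > 0\<close> by (simp add: divide_inverse_commute[symmetric] pos_divide_le_eq)
    then show ?case
      using \<open>e > 0\<close> by (simp add: k_def)
  qed
  then show "\<exists>no. \<forall>m\<ge>no. norm ((x (b m) - x (a m)) /\<^sub>R (b m - a m) - w) < e"
    by (simp add: eventually_sequentially)
qed

definition slope :: "real \<Rightarrow> nat \<Rightarrow> (real \<Rightarrow> 'a::real_normed_vector) \<Rightarrow> real \<Rightarrow> 'a" where
  "slope T m x t = (x (cell_right T m t) - x (cell_left T m t)) /\<^sub>R (T / 2 ^ m)"

text \<open>Negative times keep the history, so that delayed arguments make sense. At
  \<open>t = T > 0\<close> the slope refers to \<open>x\<close> beyond \<open>T\<close>, but its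
  factor \<open>t - cell_left T m t\<close> is 0.\<close>

definition interpolant :: "real \<Rightarrow> nat \<Rightarrow> (real \<Rightarrow> 'a::real_normed_vector) \<Rightarrow> real \<Rightarrow> 'a" where
  "interpolant T m x t =
     (if t < 0 then x t else x (cell_left T m t) + (t - cell_left T m t) *\<^sub>R slope T m x t)"

lemma interpolant_grid_pt:
  assumes "0 < T"
  shows "interpolant T m x (grid_pt T m i) = x (grid_pt T m i)"
  by (simp add: interpolant_def cell_left_grid_pt[OF assms])

lemma slope_grid_cell:
  assumes "0 < T" "i \<ge> 1" "t \<in> grid_cell T m i"
  shows "slope T m x t = (x (grid_pt T m i) - x (grid_pt T m (i - 1))) /\<^sub>R (T / 2 ^ m)"
  using cell_left_right_grid_cell[OF assms] by (simp add: slope_def)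

lemma grid_cell_nonneg:
  assumes "0 < T" "t \<in> grid_cell T m i"
  shows "0 \<le> t"
  using assms grid_pt_mono[OF assms(1), of 0 "i - 1" m] by (auto simp: grid_cell_def)

text \<open>At the right end the floor has moved on to the next cell, but both affine pieces take
  the value of \<open>x\<close> there. The formula thus holds on the closed cell, which lets
  adjacent pieces be glued.\<close>

lemma interpolant_closed_cell:
  assumes "0 < T" "i \<ge> 1" "t \<in> {grid_pt T m (i - 1)..grid_pt T m i}"
  shows "interpolant T m x t = x (grid_pt T m (i - 1))
    + (t - grid_pt T m (i - 1)) *\<^sub>R ((x (grid_pt T m i) - x (grid_pt T m (i - 1))) /\<^sub>R (T / 2 ^ m))"
proof (cases "t = grid_pt T m i")
  case True
  then show ?thesis
    using assms(1) by (simp add: interpolant_grid_pt grid_pt_diff[OF assms(2)] del: One_nat_def)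
next
  case False
  then have t: "t \<in> grid_cell T m i"
    using assms(3) by (auto simp: grid_cell_def)
  then show ?thesis
    using grid_cell_nonneg[OF assms(1) t] cell_left_right_grid_cell(1)[OF assms(1,2) t]
      slope_grid_cell[OF assms(1,2) t, of x] by (simp add: interpolant_def)
qed

lemma velocity_interpolant:
  assumes "0 < T" "i \<ge> 1" "t \<in> {grid_pt T m (i - 1)<..<grid_pt T m i}"
  shows "(interpolant T m x has_vector_derivative slope T m x t) (at t)"
proof -
  have t: "t \<in> grid_cell T m i"
    using assms(3) by (auto simp: grid_cell_def)
  have "((\<lambda>s. x (grid_pt T m (i - 1)) + (s - grid_pt T m (i - 1)) *\<^sub>R slope T m x t)
      has_vector_derivative slope T m x t) (at t)"
    by (auto intro!: derivative_eq_intros)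
  then show ?thesis
  proof (rule has_vector_derivative_transform_within_open[where S = "{grid_pt T m (i - 1)<..<grid_pt T m i}"])
    fix s assume "s \<in> {grid_pt T m (i - 1)<..<grid_pt T m i}"
    then show "x (grid_pt T m (i - 1)) + (s - grid_pt T m (i - 1)) *\<^sub>R slope T m x t = interpolant T m x s"
      using interpolant_closed_cell[OF assms(1,2), of s m x] slope_grid_cell[OF assms(1,2) t, of x] by simp
  qed (use assms(3) in auto)
qed

text \<open>A chord of an \<open>L\<close>-Lipschitz function has slope at most \<open>L\<close>, so
  each affine piece keeps the constant; the pieces are glued one grid point at a time.\<close>

lemma lipschitz_on_interpolant:
  assumes "0 < T" and lip: "L-lipschitz_on {0..T} x"
  shows "L-lipschitz_on {0..T} (interpolant T m x)"
proof -
  have "L-lipschitz_on {0..grid_pt T m k} (interpolant T m x)" if "k \<le> 2 ^ m" for k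
    using that
  proof (induction k)
    case 0
    show ?case
      using lipschitz_on_nonneg[OF lip] by (auto intro!: lipschitz_onI)
  next
    case (Suc k)
    define h where "h = T / 2 ^ m"
    have "h > 0"
      using assms(1) by (simp add: h_def)
    have "norm (x (grid_pt T m (Suc k)) - x (grid_pt T m k)) \<le> L * h"
      using lipschitz_onD[OF lip grid_pt_in_interval grid_pt_in_interval, of "Suc k" m k m] assms(1) Suc.prems
        grid_pt_diff[of "Suc k" T m] \<open>h > 0\<close> by (simp add: dist_norm h_def)
    then have "norm ((x (grid_pt T m (Suc k)) - x (grid_pt T m k)) /\<^sub>R h) \<le> L"
      using \<open>h > 0\<close> by (simp add: pos_divide_le_eq divide_inverse_commute[symmetric])
    moreover define D where "D = (x (grid_pt T m (Suc k)) - x (grid_pt T m k)) /\<^sub>R h"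
    ultimately have D: "norm D \<le> L"
      by simp
    have affine: "interpolant T m x s = x (grid_pt T m k) + (s - grid_pt T m k) *\<^sub>R D"
      if "s \<in> {grid_pt T m k..grid_pt T m (Suc k)}" for s
      using interpolant_closed_cell[OF assms(1), of "Suc k" s m x] that by (simp add: D_def h_def)
    have "L-lipschitz_on {grid_pt T m k..grid_pt T m (Suc k)} (interpolant T m x)"
    proof (rule lipschitz_onI)
      fix s t assume "s \<in> {grid_pt T m k..grid_pt T m (Suc k)}" "t \<in> {grid_pt T m k..grid_pt T m (Suc k)}"
      then have "interpolant T m x s - interpolant T m x t = (s - t) *\<^sub>R D"
        by (simp add: affine scaleR_diff_left)
      then show "dist (interpolant T m x s) (interpolant T m x t) \<le> L * dist s t"
        using mult_left_mono[OF D, of "\<bar>s - t\<bar>"] by (simp add: dist_norm mult.commute)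
    qed (rule lipschitz_on_nonneg[OF lip])
    \<comment> \<open>Both branches coincide; the conditional is the shape in which two Lipschitz
      pieces are joined at \<open>grid_pt T m k\<close>.\<close>
    then have "L-lipschitz_on {0..grid_pt T m (Suc k)}
        (\<lambda>t. if t \<le> grid_pt T m k then interpolant T m x t else interpolant T m x t)"
      using Suc.IH Suc.prems by (intro lipschitz_on_concat) auto
    then show ?case
      by simp
  qed
  from this[of "2 ^ m"] show ?thesis
    by simp
qed

lemma AE_off_grid:
  assumes "0 < T"
  shows "AE t in lebesgue_on {0..T}. \<exists>i\<in>{1..2 ^ m}. t \<in> {grid_pt T m (i - 1)<..<grid_pt T m i}"
proof -
  have "range (grid_pt T m) \<in> null_sets lebesgue"
    by (intro null_sets_completionI countable_imp_null_set_lborel) simp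
  then have "AE t in lebesgue. t \<notin> range (grid_pt T m)"
    by (rule AE_not_in)
  then have "AE t in lebesgue. t \<in> {0..T} \<longrightarrow> (\<exists>i\<in>{1..2 ^ m}. t \<in> {grid_pt T m (i - 1)<..<grid_pt T m i})"
  proof eventually_elim
    case (elim t)
    show ?case
    proof
      assume "t \<in> {0..T}"
      moreover have "t \<noteq> T"
        using elim grid_pt_top[of T m] by (metis rangeI)
      ultimately have "t \<in> {0..<T}"
        by auto
      then obtain i where "i \<in> {1..2 ^ m}" "t \<in> grid_cell T m i"
        using grid_cell_exists[OF assms] by blast
      moreover have "t \<noteq> grid_pt T m (i - 1)"
        using elim by blast
      ultimately show "\<exists>i\<in>{1..2 ^ m}. t \<in> {grid_pt T m (i - 1)<..<grid_pt T m i}"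
        by (force simp: grid_cell_def)
    qed
  qed
  then show ?thesis
    by (subst AE_restrict_space_iff) auto
qed

text \<open>At a kink \<open>velocity\<close> is an unspecified value; on \<open>{0..T}\<close> it
  differs from the step function \<open>slope\<close> at most at the finitely many grid
  points.\<close>

lemma measurable_velocity_interpolant:
  fixes x :: "real \<Rightarrow> 'a::euclidean_space"
  assumes "0 < T"
  shows "velocity (interpolant T m x) \<in> borel_measurable (lebesgue_on {0..T})"
proof (rule measurable_discrete_difference[where X = "grid_pt T m ` {..2 ^ m}" and f = "slope T m x"])
  show "slope T m x \<in> borel_measurable (lebesgue_on {0..T})"
    unfolding slope_def by (rule measurable_cell)
  show "slope T m x t = velocity (interpolant T m x) t"
    if t: "t \<in> space (lebesgue_on {0..T})" "t \<notin> grid_pt T m ` {..2 ^ m}" for t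
  proof -
    have "t \<noteq> T"
      using t grid_pt_top[of T m] by (metis atMost_iff imageI order_refl)
    then have "t \<in> {0..<T}"
      using t by auto
    then obtain i where i: "i \<in> {1..2 ^ m}" "t \<in> grid_cell T m i"
      using grid_cell_exists[OF assms] by blast
    then have "t \<noteq> grid_pt T m (i - 1)"
      using t(2) by auto
    then have "t \<in> {grid_pt T m (i - 1)<..<grid_pt T m i}"
      using i(2) by (auto simp: grid_cell_def)
    then show ?thesis
      using velocity_interpolant[OF assms, of i t m x] i(1) by (auto dest: vector_derivative_at)
  qed
qed (use grid_pt_in_interval[OF assms] in \<open>auto simp: countable_finite sets_restrict_space_iff\<close>)

section \<open>Continuity of states and constraints on controls\<close>

lemma abs_continuous_on_imp_continuous_on:
  assumes "abs_continuous_on f a b"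
  shows "continuous_on {a..b} f"
proof -
  have "\<exists>d>0. \<forall>t\<in>{a..b}. dist t s < d \<longrightarrow> dist (f t) (f s) < e" if "s \<in> {a..b}" "e > 0" for s e
  proof -
    obtain \<eta> where "\<eta> > 0"
      and \<eta>: "\<And>d S. d division_of S \<Longrightarrow> S \<subseteq> {a..b} \<Longrightarrow> (\<Sum>k\<in>d. Sup k - Inf k) < \<eta> \<Longrightarrow>
              (\<Sum>k\<in>d. norm (f (Sup k) - f (Inf k))) < e"
      using assms \<open>e > 0\<close> unfolding abs_continuous_on_def by meson
    have "norm (f q - f p) < e" if "p \<in> {a..b}" "q \<in> {a..b}" "p \<le> q" "q - p < \<eta>" for p q
      using \<eta>[of "{{p..q}}" "{p..q}"] that division_of_self[of p q] by auto
    note close = this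
    have "norm (f t - f s) < e" if "t \<in> {a..b}" "\<bar>t - s\<bar> < \<eta>" for t
      using that \<open>s \<in> {a..b}\<close> close[of s t] close[of t s] norm_minus_commute[of "f t" "f s"]
      by (cases "s \<le> t") simp_all
    then show ?thesis
      using \<open>\<eta> > 0\<close> by (auto simp: dist_norm)
  qed
  then show ?thesis
    by (auto simp: continuous_on_iff)
qed

lemma continuous_on_tendsto_at_right:
  fixes f :: "real \<Rightarrow> 'a::topological_space"
  assumes "continuous_on {a..b} f" "t \<in> {a..<b}"
  shows "(f \<longlongrightarrow> f t) (at_right t)"
proof -
  have "continuous_on {t..b} f"
    using assms(2) by (auto intro: continuous_on_subset[OF assms(1)])
  then have "(f \<longlongrightarrow> f t) (at t within {t..b})"
    using assms(2) by (auto simp: continuous_on_def)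
  then show ?thesis
    using assms(2) by (simp add: at_within_Icc_at_right)
qed

text \<open>A value outside the closed set would, by right continuity, keep \<open>u\<close> outside
  it on a whole interval to the right of \<open>t\<close>, which has positive measure. Sampling the
  control at single points requires this pointwise form of the constraint.\<close>

lemma AE_closed_right_continuous:
  fixes u :: "real \<Rightarrow> 'a::topological_space"
  assumes "closed U" and ae: "AE t in lebesgue_on {a..b}. u t \<in> U"
    and "t \<in> {a..<b}" and cont: "continuous (at_right t) u"
  shows "u t \<in> U"
proof (rule ccontr)
  assume "u t \<notin> U"
  then have "\<forall>\<^sub>F s in at_right t. u s \<in> - U"
    using cont \<open>closed U\<close> by (intro topological_tendstoD) (auto simp: continuous_within)
  then obtain d where d: "d > t" "\<And>s. s \<in> {t<..<d} \<Longrightarrow> u s \<notin> U"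
    by (auto simp: eventually_at_right_field)
  define e where "e = min d b"
  have "AE s in lebesgue. s \<in> {a..b} \<longrightarrow> u s \<in> U"
    using ae by (subst (asm) AE_restrict_space_iff) auto
  then have "AE s in lebesgue. s \<notin> {t<..<e}"
    by eventually_elim (use d(2) assms(3) in \<open>auto simp: e_def\<close>)
  then have "{t<..<e} \<in> null_sets lebesgue"
    by (simp add: AE_iff_null_sets)
  then have "negligible {t<..<e}"
    by (simp add: negligible_iff_null_sets)
  then show False
    using open_not_negligible[of "{t<..<e}"] d(1) assms(3) by (simp add: e_def not_le)
qed

lemma cell_constant_on:
  assumes "0 < T" "1 \<le> i"
  shows "(\<lambda>t. f (cell_left T m t) (cell_right T m t)) constant_on grid_cell T m i"
  using cell_left_right_grid_cell[OF assms] by (auto simp: constant_on_def)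

section \<open>Convergence of the interpolants\<close>

lemma slope_bound:
  assumes "0 < T" "L-lipschitz_on {0..T} x" "t \<in> {0..<T}"
  shows "norm (slope T m x t) \<le> L"
proof -
  have "cell_left T m t \<in> {0..T}" "cell_right T m t \<in> {0..T}"
    using cell_left_nonneg[OF assms(1), of t m] cell_bounds[OF assms(1), where m = m and t = t]
      cell_right_le[OF assms(1,3), of m] assms(3) by auto
  then have "norm (x (cell_right T m t) - x (cell_left T m t)) \<le> L * (T / 2 ^ m)"
    using lipschitz_onD[OF assms(2), of "cell_right T m t" "cell_left T m t"] assms(1)
    by (simp add: dist_norm cell_right_def)
  moreover have "T / 2 ^ m > 0"
    using assms(1) by simp
  ultimately show ?thesis
    unfolding slope_def by (simp only: norm_scaleR norm_inverse real_norm_def abs_of_pos[OF positive_imp_inverse_positive]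
        divide_inverse_commute[symmetric] pos_divide_le_eq)
qed

text \<open>One \<open>L * (T / 2 ^ m)\<close> pays for moving to the left grid point, the other for
  the affine term. Negative \<open>t\<close> are included because the estimate is applied at delayed
  times.\<close>

lemma interpolant_close:
  assumes "0 < T" "L-lipschitz_on {0..T} x" "t \<le> T"
  shows "norm (interpolant T m x t - x t) \<le> 2 * L * (T / 2 ^ m)"
proof (cases "t \<in> {0..<T}")
  case True
  let ?l = "cell_left T m t"
  have "L \<ge> 0"
    by (rule lipschitz_on_nonneg[OF assms(2)])
  have l: "?l \<in> {0..T}" "\<bar>t - ?l\<bar> \<le> T / 2 ^ m"
    using cell_left_nonneg[OF assms(1), of t m] cell_bounds[OF assms(1), where m = m and t = t] True
    by (auto simp: cell_right_def)
  have "interpolant T m x t - x t = (x ?l - x t) + (t - ?l) *\<^sub>R slope T m x t"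
    using True by (simp add: interpolant_def)
  also have "norm \<dots> \<le> norm (x ?l - x t) + \<bar>t - ?l\<bar> * norm (slope T m x t)"
    by (metis norm_scaleR norm_triangle_ineq real_norm_def)
  also have "\<dots> \<le> L * \<bar>t - ?l\<bar> + \<bar>t - ?l\<bar> * L"
    using lipschitz_onD[OF assms(2), of ?l t] l True slope_bound[OF assms(1,2) True]
    by (intro add_mono mult_left_mono) (auto simp: dist_norm abs_minus_commute)
  also have "\<dots> = 2 * L * \<bar>t - ?l\<bar>"
    by simp
  also have "\<dots> \<le> 2 * L * (T / 2 ^ m)"
    using l(2) \<open>L \<ge> 0\<close> by (intro mult_left_mono) auto
  finally show ?thesis .
next
  case False
  then consider "t < 0" | "t = T"
    using assms(3) by (meson atLeastLessThan_iff not_le order_antisym)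
  then have "interpolant T m x t = x t"
  proof cases
    case 2
    then show ?thesis
      using interpolant_grid_pt[OF assms(1), of m x "2 ^ m"] by simp
  qed (simp add: interpolant_def)
  then show ?thesis
    using assms(1) lipschitz_on_nonneg[OF assms(2)] by simp
qed

lemma tendsto_slope:
  assumes "0 < T" "x differentiable (at t)"
  shows "(\<lambda>m. slope T m x t) \<longlonglongrightarrow> velocity x t"
proof -
  have "(x has_vector_derivative velocity x t) (at t)"
    using assms(2) by (simp add: vector_derivative_works)
  from tendsto_difference_quotient_straddle[OF this tendsto_cell_left[OF assms(1)] tendsto_cell_right[OF assms(1)]]
  have "(\<lambda>m. (x (cell_right T m t) - x (cell_left T m t)) /\<^sub>R (cell_right T m t - cell_left T m t)) \<longlonglongrightarrow> velocity x t"
    using cell_bounds[OF assms(1), where t = t] by (simp add: cell_right_def less_imp_le assms(1))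
  then show ?thesis
    by (simp add: slope_def cell_right_def)
qed

text \<open>The velocities of the interpolants are difference quotients bounded by \<open>L\<close>,
  and they converge wherever \<open>x\<close> is differentiable because each cell straddles
  \<open>t\<close>; bounded convergence makes this strong.\<close>

lemma tendsto_W12_interpolant:
  fixes x :: "real \<Rightarrow> 'a::euclidean_space"
  assumes "0 < T" and lip: "L-lipschitz_on {0..T} x" and w12: "in_W12 T x"
    and vel: "AE t in lebesgue_on {0..T}. norm (velocity x t) \<le> L"
  shows "tendsto_W12 T (\<lambda>m. interpolant T m x) x"
proof -
  let ?x = "\<lambda>m. interpolant T m x"
  note lip_m = lipschitz_on_interpolant[OF \<open>0 < T\<close> lip]
  have lmeas: "{0..T} \<in> lmeasurable"
    by simp
  have "L \<ge> 0"
    by (rule lipschitz_on_nonneg[OF lip])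
  have vel_m: "AE t in lebesgue_on {0..T}. ?x m differentiable (at t) \<and> velocity (?x m) t = slope T m x t" for m
    using AE_off_grid[OF \<open>0 < T\<close>, of m]
  proof eventually_elim
    case (elim t)
    then obtain i where i: "i \<in> {1..2 ^ m}" "t \<in> {grid_pt T m (i - 1)<..<grid_pt T m i}"
      by blast
    then have "(?x m has_vector_derivative slope T m x t) (at t)"
      using velocity_interpolant[OF \<open>0 < T\<close>] by auto
    then show ?case
      using vector_derivative_at differentiableI_vector by blast
  qed
  have vel_bound: "AE t in lebesgue_on {0..T}. norm (velocity (?x m) t) \<le> L" for m
    using vel_m[of m] AE_lebesgue_on_interior[of 0 T]
    by eventually_elim (use slope_bound[OF \<open>0 < T\<close> lip] in auto)
  have "in_W12 T (?x m)" for m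
    unfolding in_W12_def
  proof (intro conjI)
    show "abs_continuous_on (?x m) 0 T"
      by (rule abs_continuous_on_lipschitz[OF lip_m])
    show "AE t in lebesgue_on {0..T}. ?x m differentiable (at t)"
      using vel_m[of m] by eventually_elim simp
    show "in_L2 {0..T} (velocity (?x m))"
      by (rule in_L2_bounded[OF lmeas measurable_velocity_interpolant[OF \<open>0 < T\<close>] vel_bound])
  qed
  moreover have "tendsto_L2 {0..T} ?x x"
  proof (rule tendsto_L2_bounded[OF lmeas, where B = "norm (x 0) + L * T"])
    show "?x m \<in> borel_measurable (lebesgue_on {0..T})" "x \<in> borel_measurable (lebesgue_on {0..T})" for m
      using lipschitz_on_continuous_on[OF lip_m] lipschitz_on_continuous_on[OF lip]
      by (auto intro!: continuous_imp_measurable_on_sets_lebesgue)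
    have bound: "norm (y t) \<le> norm (x 0) + L * T"
      if "L-lipschitz_on {0..T} y" "y 0 = x 0" "t \<in> {0..T}" for y t
    proof -
      have "norm (y t - y 0) \<le> L * \<bar>t - 0\<bar>"
        using lipschitz_onD[OF that(1,3), of 0] that(3) by (simp add: dist_norm)
      also have "\<dots> \<le> L * T"
        using that(3) \<open>L \<ge> 0\<close> by (intro mult_left_mono) auto
      finally show ?thesis
        using norm_triangle_sub[of "y t" "y 0"] that(2) by simp
    qed
    have "?x m 0 = x 0" for m
      using interpolant_grid_pt[OF \<open>0 < T\<close>, of m x 0] by simp
    then show "AE t in lebesgue_on {0..T}. norm (?x m t) \<le> norm (x 0) + L * T"
      "AE t in lebesgue_on {0..T}. norm (x t) \<le> norm (x 0) + L * T" for m
      using bound[OF lip_m] bound[OF lip] by (auto intro!: AE_I2)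
    have "(\<lambda>m. ?x m t) \<longlonglongrightarrow> x t" if "t \<le> T" for t
    proof (rule LIM_zero_cancel, rule tendsto_norm_zero_cancel)
      show "(\<lambda>m. norm (?x m t - x t)) \<longlonglongrightarrow> 0"
      proof (rule tendsto_sandwich[where f = "\<lambda>_. 0"])
        show "(\<lambda>m. 2 * L * (T / 2 ^ m)) \<longlonglongrightarrow> 0"
          by (rule tendsto_mult_right_zero[OF tendsto_mesh])
      qed (use interpolant_close[OF \<open>0 < T\<close> lip that] in auto)
    qed
    then show "AE t in lebesgue_on {0..T}. (\<lambda>m. ?x m t) \<longlonglongrightarrow> x t"
      by (auto intro!: AE_I2)
  qed
  moreover have "tendsto_L2 {0..T} (\<lambda>m. velocity (?x m)) (velocity x)"
  proof (rule tendsto_L2_bounded[OF lmeas measurable_velocity_interpolant[OF \<open>0 < T\<close>] _ vel_bound vel])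
    show "velocity x \<in> borel_measurable (lebesgue_on {0..T})"
      using w12 by (simp add: in_W12_def in_L2_def)
    have "AE t in lebesgue_on {0..T}. x differentiable (at t)"
      using w12 by (simp add: in_W12_def)
    moreover have "AE t in lebesgue_on {0..T}. \<forall>m. velocity (?x m) t = slope T m x t"
      using vel_m by (subst AE_all_countable) (auto elim!: eventually_mono)
    ultimately show "AE t in lebesgue_on {0..T}. (\<lambda>m. velocity (?x m) t) \<longlonglongrightarrow> velocity x t"
    proof eventually_elim
      case (elim t)
      then have "(\<lambda>m. slope T m x t) \<longlonglongrightarrow> velocity x t"
        using tendsto_slope[OF \<open>0 < T\<close>] by blast
      then show ?case
        using elim by simp
    qed
  qed
  ultimately show ?thesis
    using w12 by (simp add: tendsto_W12_def)
qed

text \<open>Convergence at \<open>T\<close> is conditional: the control is constrained only almost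
  everywhere and right continuous only before \<open>T\<close>, so \<open>ubar T\<close> may lie
  outside \<open>U\<close>, while limits of values in the closed set \<open>U\<close>
  cannot.\<close>

theorem theorem3p3:
  fixes C :: "(real ^ 'n) set"
    and s :: nat and xstar :: "nat \<Rightarrow> real ^ 'n" and c :: "nat \<Rightarrow> real"
    and T :: real
    and U :: "(real ^ 'd) set"
    and g :: "real \<Rightarrow> real ^ 'n \<Rightarrow> real ^ 'n \<Rightarrow> real ^ 'd \<Rightarrow> real ^ 'n"
    and \<delta> :: "real \<Rightarrow> real" and \<Delta> :: real
    and \<phi> :: "real \<Rightarrow> real ^ 'n"
    and xbar :: "real \<Rightarrow> real ^ 'n" and ubar :: "real \<Rightarrow> real ^ 'd"
  assumes C_def: "C = (\<Inter>j\<in>{1..s}. {x. xstar j \<bullet> x \<le> c j})"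
    and xstar_unit: "\<And>j. j \<in> {1..s} \<Longrightarrow> norm (xstar j) = 1"
    and T_pos: "T > 0"
    and H1: "U \<noteq> {}" "compact U"
    and H2: "continuous_on ({0..T} \<times> UNIV \<times> UNIV \<times> UNIV) (\<lambda>(t, x, y, u). g t x y u)"
      "\<And>B. bounded B \<Longrightarrow> \<exists>L. \<forall>u\<in>U. L-lipschitz_on ({0..T} \<times> B) (\<lambda>(t, x, y). g t x y u)"
    and H3: "\<exists>\<beta>>0. \<forall>t\<in>{0..T}. \<forall>x y. \<forall>u\<in>U. norm (g t x y u) \<le> \<beta> * (1 + norm x + norm y)"
    and H4: "\<And>t. t \<in> {0..T} \<Longrightarrow> \<delta> t \<ge> 0"
      "\<exists>L. L-lipschitz_on {0..T} \<delta>"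
      "antimono_on {0..T} \<delta>"
      "\<Delta> \<in> \<delta> ` {0..T}" "\<And>t. t \<in> {0..T} \<Longrightarrow> \<delta> t \<le> \<Delta>" "0 < \<Delta>"
    and H5: "\<exists>L. L-lipschitz_on {-\<Delta>..0} \<phi>"
    and feasible: "feasible_process C U g \<delta> \<Delta> \<phi> T xbar ubar"
    and ubar_bv: "bounded_variation_on ubar 0 T"
    and ubar_rcont: "\<And>t. t \<in> {0..<T} \<Longrightarrow> continuous (at_right t) ubar"
  shows "\<exists>(x :: nat \<Rightarrow> real \<Rightarrow> real ^ 'n) (u :: nat \<Rightarrow> real \<Rightarrow> real ^ 'd)
          (r :: nat \<Rightarrow> real \<Rightarrow> real) (\<rho> :: nat \<Rightarrow> real \<Rightarrow> real ^ 'n).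
     \<comment> \<open>(i)\<close>
     (\<forall>m. \<forall>t\<in>{0..T}. u m t \<in> U) \<and>
     (\<forall>m. \<forall>i\<in>{1..2^m}. u m constant_on grid_cell T m i) \<and>
     tendsto_L2 {0..T} u ubar \<and>
     (\<forall>t\<in>{0..<T}. (\<lambda>m. u m t) \<longlonglongrightarrow> ubar t) \<and>
     (ubar T \<in> U \<longrightarrow> (\<lambda>m. u m T) \<longlonglongrightarrow> ubar T) \<and>
     \<comment> \<open>(ii)\<close>
     (\<forall>m. continuous_on {0..T} (x m)) \<and>
     (\<forall>m. \<forall>i\<in>{1..2^m}. \<exists>a b. \<forall>t\<in>grid_cell T m i. x m t = a + t *\<^sub>R b) \<and>
     tendsto_W12 T x xbar \<and>
     (\<forall>m. \<forall>i\<in>{1..2^m}. x m (grid_pt T m i) = xbar (grid_pt T m i) \<and> xbar (grid_pt T m i) \<in> C) \<and>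
     (\<forall>m. x m 0 = \<phi> 0) \<and>
     \<comment> \<open>(iii)\<close>
     (\<forall>m. \<forall>i\<in>{1..2^m}. \<forall>t\<in>{grid_pt T m (i - 1)<..<grid_pt T m i}.
        velocity (x m) t \<in>
          {- \<nu> - g (grid_pt T m i) (x m (grid_pt T m i))
                    (x m (grid_pt T m i - \<delta> (grid_pt T m i))) (u m t)
             + r m t *\<^sub>R \<rho> m t
           |\<nu>. \<nu> \<in> normal_cone C (x m (grid_pt T m i))}) \<and>
     (\<forall>m. \<forall>s\<in>{-\<Delta>..0}. x m s = \<phi> s) \<and>
     (\<forall>m. \<forall>t\<in>{0..T}. 0 \<le> r m t \<and> \<rho> m t \<in> cball 0 1) \<and>
     (\<forall>m. \<forall>i\<in>{1..2^m}. r m constant_on grid_cell T m i \<and> \<rho> m constant_on grid_cell T m i) \<and>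
     tendsto_L2 {0..T} r (\<lambda>_. 0) \<and>
     \<comment> \<open>common Lipschitz constant\<close>
     (\<exists>L. L-lipschitz_on {0..T} xbar) \<and>
     (\<forall>L. L-lipschitz_on {0..T} xbar \<longrightarrow> (\<forall>m. L-lipschitz_on {0..T} (x m)))"
proof -
  have C_eq: "C = polyhedron_of {1..s} xstar c"
    unfolding C_def polyhedron_of_def by blast
  have w12: "in_W12 T xbar"
    and hist: "\<And>t. t \<in> {-\<Delta>..0} \<Longrightarrow> xbar t = \<phi> t"
    and xC: "\<And>t. t \<in> {0..T} \<Longrightarrow> xbar t \<in> C"
    and ubar_meas: "ubar \<in> borel_measurable (lebesgue_on {0..T})"
    and ubar_ae: "AE t in lebesgue_on {0..T}. ubar t \<in> U"
    and sweep0: "AE t in lebesgue_on {0..T}.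
        - velocity xbar t \<in> {\<nu> + g t (xbar t) (xbar (t - \<delta> t)) (ubar t) |\<nu>. \<nu> \<in> normal_cone C (xbar t)}"
    using feasible by (auto simp: feasible_process_def)
  have ac: "abs_continuous_on xbar 0 T"
    and diff: "AE t in lebesgue_on {0..T}. xbar differentiable (at t)"
    using w12 by (auto simp: in_W12_def)
  have delay: "t - \<delta> t \<in> {-\<Delta>..T}" if "t \<in> {0..T}" for t
    using H4(1)[OF that] H4(5)[OF that] that by auto
  have "\<Delta> > 0" "closed U"
    using H4(6) H1(2) by (auto simp: compact_imp_closed)

  have cont_x: "continuous_on {0..T} xbar"
    by (rule abs_continuous_on_imp_continuous_on[OF ac])
  have "continuous_on {-\<Delta>..0} xbar"
    using H5 hist lipschitz_on_continuous_on by (metis continuous_on_cong)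
  \<comment> \<open>History and trajectory meet at 0, so delayed arguments, which range over
    \<open>{-\<Delta>..T}\<close>, see one continuous function.\<close>
  then have "continuous_on ({-\<Delta>..0} \<union> {0..T}) xbar"
    using cont_x by (intro continuous_on_closed_Un) auto
  then have cont_ext: "continuous_on {-\<Delta>..T} xbar"
    using \<open>\<Delta> > 0\<close> T_pos by (simp add: ivl_disj_un_two_touch)
  have cont_\<delta>: "continuous_on {0..T} \<delta>"
    using H4(2) lipschitz_on_continuous_on by blast
  have cont_delay: "continuous_on {0..T} (\<lambda>t. xbar (t - \<delta> t))"
    using delay by (intro continuous_on_compose2[OF cont_ext] continuous_intros cont_\<delta>) auto
  obtain K where K: "\<And>t. t \<in> {-\<Delta>..T} \<Longrightarrow> norm (xbar t) \<le> K"
    using compact_continuous_image[OF cont_ext] compact_imp_bounded by (fastforce simp: bounded_iff)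
  have "K \<ge> 0"
    using order_trans[OF norm_ge_zero K[of T]] \<open>\<Delta> > 0\<close> T_pos by simp

  obtain \<beta> where "\<beta> > 0"
    and \<beta>: "\<And>t y z u. t \<in> {0..T} \<Longrightarrow> u \<in> U \<Longrightarrow> norm (g t y z u) \<le> \<beta> * (1 + norm y + norm z)"
    using H3 by blast
  have g_bound: "norm (g t y z u) \<le> \<beta> * (1 + A + B)"
    if "t \<in> {0..T}" "u \<in> U" "norm y \<le> A" "norm z \<le> B" for t y z u A B
  proof -
    have "\<beta> * (1 + norm y + norm z) \<le> \<beta> * (1 + A + B)"
      using that \<open>\<beta> > 0\<close> by (intro mult_left_mono) auto
    then show ?thesis
      using \<beta>[OF that(1,2), of y z] by linarith
  qed
  \<comment> \<open>The filter is left general: \<open>at_right t\<close> serves for the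
    perturbation along \<open>xbar\<close>, \<open>sequentially\<close> for the grid values.\<close>
  have g_tendsto: "((\<lambda>m. g (a m) (y m) (z m) (v m)) \<longlongrightarrow> g a0 y0 z0 v0) F"
    if "(a \<longlongrightarrow> a0) F" "(y \<longlongrightarrow> y0) F" "(z \<longlongrightarrow> z0) F" "(v \<longlongrightarrow> v0) F"
      "\<forall>\<^sub>F m in F. a m \<in> {0..T}" "a0 \<in> {0..T}" for a y z v a0 y0 z0 v0 and F :: "'e filter"
  proof -
    have "((\<lambda>m. (a m, y m, z m, v m)) \<longlongrightarrow> (a0, y0, z0, v0)) F"
      using that by (intro tendsto_Pair)
    moreover have "\<forall>\<^sub>F m in F. (a m, y m, z m, v m) \<in> {0..T} \<times> UNIV \<times> UNIV \<times> UNIV"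
      using that(5) by eventually_elim auto
    ultimately show ?thesis
      using continuous_on_tendsto_compose[OF H2(1)] that(6) by fastforce
  qed

  have ubar_U: "ubar t \<in> U" if "t \<in> {0..<T}" for t
    by (rule AE_closed_right_continuous[OF \<open>closed U\<close> ubar_ae that ubar_rcont[OF that]])
  have ubar_lim: "(ubar \<longlongrightarrow> ubar t) (at_right t)" if "t \<in> {0..<T}" for t
    using ubar_rcont[OF that] by (simp add: continuous_within)

  define f where "f t = g t (xbar t) (xbar (t - \<delta> t)) (ubar t)" for t
  \<comment> \<open>The control may jump, but right continuity of \<open>f\<close> is exactly what
    persistence of normals asks for.\<close>
  have f_lim: "(f \<longlongrightarrow> f t) (at_right t)" if t: "t \<in> {0..<T}" for t
    unfolding f_def
  proof (rule g_tendsto)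
    have "\<forall>\<^sub>F s in at_right t. s < T"
      using t by (auto simp: eventually_at_right_field)
    then show "\<forall>\<^sub>F s in at_right t. s \<in> {0..T}"
      using eventually_at_right_less[of t] by eventually_elim (use t in auto)
  qed (use t continuous_on_tendsto_at_right[OF cont_x t] continuous_on_tendsto_at_right[OF cont_delay t]
      ubar_lim[OF t] in auto)

  \<comment> \<open>This is (H3) with the current and the delayed state both bounded by
    \<open>K\<close>.\<close>
  define M where "M = \<beta> * (1 + K + K)"
  have "M \<ge> 0"
    using \<open>\<beta> > 0\<close> \<open>K \<ge> 0\<close> by (simp add: M_def)
  have sweep: "AE t in lebesgue_on {0..T}. xbar differentiable (at t) \<and>
      - velocity xbar t - f t \<in> normal_cone C (xbar t) \<and> norm (f t) \<le> M"
    using sweep0 diff AE_lebesgue_on_interior[of 0 T] ubar_ae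
  proof eventually_elim
    case (elim t)
    have "norm (f t) \<le> M"
      unfolding f_def M_def using elim delay[of t] \<open>\<Delta> > 0\<close> by (intro g_bound K) auto
    then show ?case
      using elim by (auto simp: f_def algebra_simps)
  qed
  have lip: "M-lipschitz_on {0..T} xbar"
    and vel: "AE t in lebesgue_on {0..T}. norm (velocity xbar t) \<le> M"
    using lipschitz_on_sweeping_trajectory[OF ac xC \<open>M \<ge> 0\<close> sweep] by auto

  \<comment> \<open>Only \<open>w T\<close> can differ from a sampled value: \<open>ubar T\<close> need not lie in \<open>U\<close>, and the value at a
    point to the right of \<open>T\<close> serves as \<open>u m T\<close>.\<close>
  define w where "w t = (if t < T then ubar t else if ubar T \<in> U then ubar T else (SOME v. v \<in> U))" for t
  have w_U: "w t \<in> U" if "t \<ge> 0" for t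
    using ubar_U[of t] that some_in_eq[of U] H1(1) by (auto simp: w_def)
  define x where "x m = interpolant T m xbar" for m
  define u where "u m t = w (cell_right T m t)" for m t
  \<comment> \<open>The vector that would have to be a normal at the right end for the discrete
    inclusion to hold without residual.\<close>
  define defect where "defect m l r = - ((xbar r - xbar l) /\<^sub>R (T / 2 ^ m))
      - g r (xbar r) (x m (r - \<delta> r)) (w r)" for m l r
  \<comment> \<open>At \<open>t = T\<close> the right end lies beyond \<open>T\<close>, where the
    cone may be empty and the closest point arbitrary; at that time only
    \<open>0 \<le> r m t\<close> and the bound on \<open>\<rho>\<close> are claimed.\<close>
  define \<nu> where "\<nu> m l r = closest_point (normal_cone C (xbar r)) (defect m l r)" for m l r
  define err where "err m l r = \<nu> m l r - defect m l r" for m l r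
  define r where "r m t = norm (err m (cell_left T m t) (cell_right T m t))" for m t
  \<comment> \<open>Since \<open>sgn 0 = 0\<close>, the product of \<open>r\<close> and
    \<open>\<rho>\<close> is the error vector even where it vanishes.\<close>
  define \<rho> where "\<rho> m t = sgn (err m (cell_left T m t) (cell_right T m t))" for m t

  have W12: "tendsto_W12 T x xbar"
    unfolding x_def by (rule tendsto_W12_interpolant[OF T_pos lip w12 vel])
  have x_close: "norm (x m t - xbar t) \<le> 2 * M * (T / 2 ^ m)" if "t \<le> T" for m t
    unfolding x_def by (rule interpolant_close[OF T_pos lip that])
  have x_grid: "x m (grid_pt T m i) = xbar (grid_pt T m i)" for m i
    unfolding x_def by (rule interpolant_grid_pt[OF T_pos])
  have x_hist: "x m t = \<phi> t" if "t \<in> {-\<Delta>..0}" for m t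
  proof (cases "t = 0")
    case True
    then show ?thesis
      using x_grid[of m 0] hist[OF that] by simp
  next
    case False
    then show ?thesis
      using hist[OF that] that by (simp add: x_def interpolant_def)
  qed
  have right: "cell_right T m t \<in> {0<..T}" if "t \<in> {0..<T}" for m t
    using cell_right_le[OF T_pos that, of m] cell_bounds(2)[OF T_pos, of t m] that by auto

  have u_lim: "(\<lambda>m. u m t) \<longlonglongrightarrow> ubar t" if t: "t \<in> {0..<T}" for t
  proof -
    have "(\<lambda>m. ubar (cell_right T m t)) \<longlonglongrightarrow> ubar t"
      by (rule filterlim_compose[OF ubar_lim[OF t] filterlim_cell_right[OF T_pos]])
    \<comment> \<open>Before \<open>T\<close> the modified control \<open>w\<close> agrees with
      \<open>ubar\<close>.\<close>
    moreover have "\<forall>\<^sub>F m in sequentially. cell_right T m t < T"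
      using tendsto_cell_right[OF T_pos, of t] t by (auto dest: order_tendstoD(2))
    then have "\<forall>\<^sub>F m in sequentially. ubar (cell_right T m t) = u m t"
      by eventually_elim (simp add: u_def w_def)
    ultimately show ?thesis
      by (rule Lim_transform_eventually)
  qed
  have u_lim_T: "(\<lambda>m. u m T) \<longlonglongrightarrow> ubar T" if "ubar T \<in> U"
  proof -
    have "u m T = ubar T" for m
      using cell_bounds(2)[OF T_pos, of T m] that by (auto simp: u_def w_def)
    then show ?thesis
      by simp
  qed
  have u_U: "u m t \<in> U" if "t \<in> {0..T}" for m t
    unfolding u_def using cell_bounds(2)[OF T_pos, of t m] that by (intro w_U) auto
  obtain R where R: "\<And>v. v \<in> U \<Longrightarrow> norm v \<le> R"
    using compact_imp_bounded[OF H1(2)] by (auto simp: bounded_iff)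
  have u_L2: "tendsto_L2 {0..T} u ubar"
  proof (rule tendsto_L2_bounded[where B = R])
    show "u m \<in> borel_measurable (lebesgue_on {0..T})" for m
      unfolding u_def by (rule measurable_cell)
    show "AE t in lebesgue_on {0..T}. norm (u m t) \<le> R" for m
      using u_U R by (auto intro!: AE_I2)
    show "AE t in lebesgue_on {0..T}. norm (ubar t) \<le> R"
      using ubar_ae by eventually_elim (rule R)
    show "AE t in lebesgue_on {0..T}. (\<lambda>m. u m t) \<longlonglongrightarrow> ubar t"
      using AE_lebesgue_on_interior[of 0 T] by eventually_elim (use u_lim in auto)
  qed (use ubar_meas in auto)

  have err_le: "norm (err m l q) \<le> norm (defect m l q - v)" if "v \<in> normal_cone C (xbar q)" for m l q v
    using closest_point_le[OF closed_normal_cone that, of "defect m l q"]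
    by (simp add: err_def \<nu>_def dist_norm norm_minus_commute)
  have defect_eq: "defect m (cell_left T m t) (cell_right T m t) = - slope T m xbar t
      - g (cell_right T m t) (xbar (cell_right T m t)) (x m (cell_right T m t - \<delta> (cell_right T m t))) (u m t)" for m t
    by (simp add: defect_def slope_def u_def)

  have r_bound: "norm (r m t) \<le> M + \<beta> * (1 + K + (K + 2 * M * T))" if t: "t \<in> {0..<T}" for m t
  proof -
    let ?q = "cell_right T m t"
    have q: "?q \<in> {0..T}"
      using right[OF t, of m] by auto
    \<comment> \<open>Replacing the coarse mesh size by \<open>T\<close> makes the bound on the
      delayed interpolant independent of \<open>m\<close>.\<close>
    have "2 * M * (T / 2 ^ m) \<le> 2 * M * T"
      using T_pos \<open>M \<ge> 0\<close> by (intro mult_left_mono) (auto simp: field_simps)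
    then have "norm (x m (?q - \<delta> ?q)) \<le> K + 2 * M * T"
      using K[OF delay[OF q]] x_close[of "?q - \<delta> ?q" m] delay[OF q]
        norm_triangle_sub[of "x m (?q - \<delta> ?q)" "xbar (?q - \<delta> ?q)"] by auto
    then have "norm (g ?q (xbar ?q) (x m (?q - \<delta> ?q)) (u m t)) \<le> \<beta> * (1 + K + (K + 2 * M * T))"
      using q t \<open>\<Delta> > 0\<close> by (intro g_bound u_U K) auto
    moreover have "norm (slope T m xbar t) \<le> M"
      by (rule slope_bound[OF T_pos lip t])
    \<comment> \<open>The zero vector is always a normal, so projecting costs at most the norm of
      the defect.\<close>
    moreover have "norm (err m (cell_left T m t) ?q) \<le> norm (defect m (cell_left T m t) ?q)"
      using err_le[OF zero_in_normal_cone[OF xC[OF q]]] by simp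
    ultimately show ?thesis
      using norm_triangle_ineq4[of "- slope T m xbar t" "g ?q (xbar ?q) (x m (?q - \<delta> ?q)) (u m t)"]
      by (simp add: r_def defect_eq)
  qed

  have r_lim: "(\<lambda>m. r m t) \<longlonglongrightarrow> 0"
    if t: "t \<in> {0<..<T}" and dt: "xbar differentiable (at t)"
      and vt: "- velocity xbar t - f t \<in> normal_cone C (xbar t)" for t
  proof -
    define v where "v = - velocity xbar t - f t"
    let ?q = "\<lambda>m. cell_right T m t"
    have t0: "t \<in> {0..<T}" "t \<in> {0..T}"
      using t by auto
    have q_right: "filterlim ?q (at_right t) sequentially"
      by (rule filterlim_cell_right[OF T_pos])
    \<comment> \<open>The delayed time is usually no grid point, so \<open>x m\<close> is first
      replaced by \<open>xbar\<close> through the uniform estimate.\<close>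
    have delay_lim: "(\<lambda>m. x m (?q m - \<delta> (?q m))) \<longlonglongrightarrow> xbar (t - \<delta> t)"
    proof (rule Lim_transform2)
      show "(\<lambda>m. xbar (?q m - \<delta> (?q m))) \<longlonglongrightarrow> xbar (t - \<delta> t)"
        by (rule filterlim_compose[OF continuous_on_tendsto_at_right[OF cont_delay t0(1)] q_right])
      have "norm (xbar (?q m - \<delta> (?q m)) - x m (?q m - \<delta> (?q m))) \<le> 2 * M * (T / 2 ^ m)" for m
        using x_close[of "?q m - \<delta> (?q m)" m] delay[of "?q m"] right[OF t0(1), of m]
        by (simp add: norm_minus_commute)
      then have "\<forall>\<^sub>F m in sequentially.
          norm (xbar (?q m - \<delta> (?q m)) - x m (?q m - \<delta> (?q m))) \<le> 2 * M * (T / 2 ^ m)"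
        by (intro always_eventually allI)
      then show "(\<lambda>m. xbar (?q m - \<delta> (?q m)) - x m (?q m - \<delta> (?q m))) \<longlonglongrightarrow> 0"
        by (rule Lim_null_comparison) (rule tendsto_mult_right_zero[OF tendsto_mesh])
    qed
    have "(\<lambda>m. g (?q m) (xbar (?q m)) (x m (?q m - \<delta> (?q m))) (u m t)) \<longlonglongrightarrow> f t"
      unfolding f_def
    proof (rule g_tendsto[OF tendsto_cell_right[OF T_pos] _ delay_lim u_lim[OF t0(1)] _ t0(2)])
      show "(\<lambda>m. xbar (?q m)) \<longlonglongrightarrow> xbar t"
        by (rule filterlim_compose[OF continuous_on_tendsto_at_right[OF cont_x t0(1)] q_right])
      show "\<forall>\<^sub>F m in sequentially. ?q m \<in> {0..T}"
        using right[OF t0(1)] by (intro always_eventually) (auto simp: less_imp_le)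
    qed
    then have "(\<lambda>m. defect m (cell_left T m t) (?q m)) \<longlonglongrightarrow> v"
      unfolding defect_eq v_def by (intro tendsto_intros tendsto_slope[OF T_pos dt])
    then have null: "(\<lambda>m. norm (defect m (cell_left T m t) (?q m) - v)) \<longlonglongrightarrow> 0"
      by (simp add: LIM_zero tendsto_norm_zero)
    have "AE s in lebesgue_on {0..T}. xbar differentiable (at s) \<and> - velocity xbar s - f s \<in> normal_cone C (xbar s)"
      using sweep by eventually_elim simp
    from sweeping_normal_persists[OF _ C_eq ac cont_x xC this t dt v_def vt[folded v_def] f_lim[OF t0(1)]]
    have "\<forall>\<^sub>F s in at_right t. v \<in> normal_cone C (xbar s)"
      by simp
    then have "\<forall>\<^sub>F m in sequentially. v \<in> normal_cone C (xbar (?q m))"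
      by (rule eventually_compose_filterlim[OF _ q_right])
    \<comment> \<open>By persistence the fixed vector \<open>v\<close> eventually competes in the
      projection onto the moving cone, so the residual is at most the distance from the defect to
      \<open>v\<close>, which tends to 0.\<close>
    then have "\<forall>\<^sub>F m in sequentially. norm (r m t) \<le> norm (defect m (cell_left T m t) (?q m) - v)"
      by eventually_elim (simp add: r_def err_le)
    then show ?thesis
      using null by (rule Lim_null_comparison)
  qed
  have r_L2: "tendsto_L2 {0..T} r (\<lambda>_. 0)"
  proof (rule tendsto_L2_bounded[where B = "M + \<beta> * (1 + K + (K + 2 * M * T))"])
    show "r m \<in> borel_measurable (lebesgue_on {0..T})" for m
      unfolding r_def by (rule measurable_cell)
    show "AE t in lebesgue_on {0..T}. norm (r m t) \<le> M + \<beta> * (1 + K + (K + 2 * M * T))" for m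
      using AE_lebesgue_on_interior[of 0 T] by eventually_elim (use r_bound in auto)
    show "AE t in lebesgue_on {0..T}. norm (0::real) \<le> M + \<beta> * (1 + K + (K + 2 * M * T))"
      using \<open>M \<ge> 0\<close> \<open>K \<ge> 0\<close> \<open>\<beta> > 0\<close> T_pos by simp
    show "AE t in lebesgue_on {0..T}. (\<lambda>m. r m t) \<longlonglongrightarrow> 0"
      using sweep AE_lebesgue_on_interior[of 0 T] by eventually_elim (use r_lim in auto)
  qed auto

  have inclusion: "velocity (x m) t \<in> {- \<nu> - g (grid_pt T m i) (x m (grid_pt T m i))
        (x m (grid_pt T m i - \<delta> (grid_pt T m i))) (u m t) + r m t *\<^sub>R \<rho> m t
      |\<nu>. \<nu> \<in> normal_cone C (x m (grid_pt T m i))}"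
    if i: "i \<in> {1..2 ^ m}" and t: "t \<in> {grid_pt T m (i - 1)<..<grid_pt T m i}" for m i t
  proof -
    let ?q = "grid_pt T m i" and ?l = "grid_pt T m (i - 1)"
    have cell: "t \<in> grid_cell T m i"
      using t by (auto simp: grid_cell_def)
    have i1: "1 \<le> i"
      using i by simp
    note lr = cell_left_right_grid_cell[OF T_pos i1 cell]
    have "velocity (x m) t = slope T m xbar t"
      unfolding x_def by (rule vector_derivative_at[OF velocity_interpolant[OF T_pos i1 t]])
    moreover have "r m t *\<^sub>R \<rho> m t = err m ?l ?q"
      by (cases "err m ?l ?q = 0") (simp_all add: r_def \<rho>_def lr sgn_div_norm)
    \<comment> \<open>\<open>err\<close> is \<open>\<nu>\<close> minus the defect, so solving for
      the slope gives the inclusion with \<open>- \<nu>\<close> and the residual added.\<close>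
    moreover have "err m ?l ?q = \<nu> m ?l ?q + slope T m xbar t
        + g ?q (x m ?q) (x m (?q - \<delta> ?q)) (u m t)"
      using defect_eq[of m t] by (simp add: err_def lr x_grid)
    moreover have "\<nu> m ?l ?q \<in> normal_cone C (x m ?q)"
    proof -
      have "xbar ?q \<in> C"
        using i by (intro xC grid_pt_in_interval[OF T_pos]) simp
      then show ?thesis
        unfolding \<nu>_def x_grid
        using closest_point_in_set[OF closed_normal_cone] zero_in_normal_cone by blast
    qed
    ultimately show ?thesis
      by (intro CollectI exI[of _ "\<nu> m ?l ?q"]) simp
  qed

  have affine: "\<exists>a b. \<forall>t\<in>grid_cell T m i. x m t = a + t *\<^sub>R b" if "i \<in> {1..2 ^ m}" for m i
  proof -
    define l where "l = grid_pt T m (i - 1)"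
    define D where "D = (xbar (grid_pt T m i) - xbar l) /\<^sub>R (T / 2 ^ m)"
    have "x m t = (xbar l - l *\<^sub>R D) + t *\<^sub>R D" if "t \<in> grid_cell T m i" for t
    proof -
      have "x m t = xbar l + (t - l) *\<^sub>R D"
        unfolding x_def l_def D_def
        using \<open>i \<in> _\<close> that by (intro interpolant_closed_cell[OF T_pos]) (auto simp: grid_cell_def)
      then show ?thesis
        by (simp add: scaleR_diff_left)
    qed
    then show ?thesis
      by blast
  qed
  show ?thesis
  proof (rule exI[of _ x], rule exI[of _ u], rule exI[of _ r], rule exI[of _ \<rho>], intro conjI)
    show "\<forall>m. \<forall>i\<in>{1..2 ^ m}. u m constant_on grid_cell T m i"
      unfolding u_def by (auto intro!: cell_constant_on[OF T_pos])
    show "\<forall>m. \<forall>i\<in>{1..2 ^ m}. r m constant_on grid_cell T m i \<and> \<rho> m constant_on grid_cell T m i"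
      unfolding r_def \<rho>_def by (auto intro!: cell_constant_on[OF T_pos])
    show "\<forall>m. continuous_on {0..T} (x m)"
      using lipschitz_on_continuous_on[OF lipschitz_on_interpolant[OF T_pos lip]] by (simp add: x_def)
    show "\<forall>m. \<forall>i\<in>{1..2 ^ m}. x m (grid_pt T m i) = xbar (grid_pt T m i) \<and> xbar (grid_pt T m i) \<in> C"
      using x_grid xC grid_pt_in_interval[OF T_pos] by auto
    show "\<forall>m. x m 0 = \<phi> 0"
      using x_hist \<open>\<Delta> > 0\<close> by simp
    show "\<forall>m. \<forall>t\<in>{0..T}. 0 \<le> r m t \<and> \<rho> m t \<in> cball 0 1"
      by (auto simp: r_def \<rho>_def norm_sgn)
    show "\<forall>L. L-lipschitz_on {0..T} xbar \<longrightarrow> (\<forall>m. L-lipschitz_on {0..T} (x m))"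
      unfolding x_def using lipschitz_on_interpolant[OF T_pos] by blast
  qed (use u_U u_L2 u_lim u_lim_T affine W12 inclusion x_hist r_L2 lip in \<open>blast+\<close>)
qed

end
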